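(* Let $m,n\ge 2$ be integers, $\mathcal{A}\in\mathbb{R}^{[m,n]}$ and $a\in\mathbb{R}^n$. If $a\in\operatorname{int}(\mathrm{Sol}(\mathcal{A},0)^+)$, then there exist constants $\varepsilon>0$, $\gamma>0$ and $c>0$ such that, if $\mathcal{B}\in\mathbb{R}^{[m,n]}$ and $b\in\mathbb{R}^n$ satisfy $$\max\{\|\mathcal{B}-\mathcal{A}\|,\|b-a\|\}<\varepsilon$$ and $\mathcal{B}$ is copositive, then the following statements hold: (a) The set $\mathrm{Sol}(\mathcal{B},b)$ is nonempty and bounded; (b) One has $$\mathrm{Sol}(\mathcal{B},b)\subset\mathrm{Sol}(\mathcal{A},a)+\gamma\left(\|\mathcal{B}-\mathcal{A}\|+\|b-a\|\right)^{c}\,\mathbb{B}(0,1).$$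
   Context: $\mathbb{R}^{[m,n]}$ is the real vector space (of dimension $n^m$) of real $m$-th order $n$-dimensional tensors $\mathcal{A}=(a_{i_1\cdots i_m})$, $i_j\in[n]=\{1,\dots,n\}$, with the Frobenius norm $\|\mathcal{A}\|=\sqrt{\sum a_{i_1\cdots i_m}^2}$; $\mathbb{R}^n$ carries the Euclidean norm. For $x\in\mathbb{R}^n$, $\mathcal{A}x^{m-1}\in\mathbb{R}^n$ has components $(\mathcal{A}x^{m-1})_i=\sum_{i_2,\dots,i_m=1}^n a_{ii_2\cdots i_m}x_{i_2}\cdots x_{i_m}$, and $\mathcal{A}x^m=\langle x,\mathcal{A}x^{m-1}\rangle$. For $a\in\mathbb{R}^n$, $\mathrm{Sol}(\mathcal{A},a)$ is the solution set of the tensor complementarity problem $\mathrm{TCP}(\mathcal{A},a)$, i.e. the set of $x\in\mathbb{R}^n$ with $x\ge 0$, $\mathcal{A}x^{m-1}+a\ge 0$, $\mathcal{A}x^m+\langle x,a\rangle=0$ (inequalities componentwise); $\mathrm{Sol}(\mathcal{A},0)$ is a closed cone. A tensor $\mathcal{B}$ is copositive if $\mathcal{B}x^m\ge 0$ for all $x\ge 0$. For a nonempty closed cone $C\subset\mathbb{R}^n$, $C^+=\{q:\langle v,q\rangle\ge 0\ \forall v\in C\}$ is its dual cone and $\operatorname{int}C^+$ its interior; $q\in\operatorname{int}C^+$ if and only if $\langle v,q\rangle>0$ for all $v\in C$, $v\ne 0$. $\mathbb{B}(0,1)$ is the closed unit ball in $\mathbb{R}^n$. *)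

theory Defs
  imports "HOL-Analysis.Analysis" "HOL-Library.Set_Algebras"
begin

text \<open>
  The dimension \<open>n\<close> is the cardinality of a finite index type \<open>'n\<close>.  A multi-index
  \<open>(i\<^sub>1, \<dots>, i\<^sub>m)\<close> is a list of length \<open>m\<close> over \<open>'n\<close>; a tensor of order \<open>m\<close> is a real function
  of lists that vanishes on all lists of any other length, so that \<open>tensors m\<close> has dimension
  \<open>n ^ m\<close>.
\<close>

type_synonym 'n tensor = "'n list \<Rightarrow> real"

definition tensors :: "nat \<Rightarrow> 'n tensor set" where
  "tensors m = {A. \<forall>js. length js \<noteq> m \<longrightarrow> A js = 0}"

definition tensor_norm :: "nat \<Rightarrow> 'n::finite tensor \<Rightarrow> real" where
  "tensor_norm m A = sqrt (\<Sum>js | length js = m. (A js)\<^sup>2)"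

text \<open>The vector \<open>A x\<^bsup>m-1\<^esup>\<close>.\<close>

definition tensor_vec :: "nat \<Rightarrow> 'n::finite tensor \<Rightarrow> real ^ 'n \<Rightarrow> real ^ 'n" where
  "tensor_vec m A x =
     (\<chi> i. \<Sum>js | length js = m - 1. A (i # js) * (\<Prod>j\<leftarrow>js. x $ j))"

text \<open>The number \<open>A x\<^bsup>m\<^esup>\<close>.\<close>

definition tensor_form :: "nat \<Rightarrow> 'n::finite tensor \<Rightarrow> real ^ 'n \<Rightarrow> real" where
  "tensor_form m A x = x \<bullet> tensor_vec m A x"

definition Sol :: "nat \<Rightarrow> 'n::finite tensor \<Rightarrow> real ^ 'n \<Rightarrow> (real ^ 'n) set" where
  "Sol m A a = {x. (\<forall>i. 0 \<le> x $ i) \<and> (\<forall>i. 0 \<le> (tensor_vec m A x + a) $ i) \<and>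
                   tensor_form m A x + x \<bullet> a = 0}"

definition copositive :: "nat \<Rightarrow> 'n::finite tensor \<Rightarrow> bool" where
  "copositive m B \<longleftrightarrow> (\<forall>x. (\<forall>i. 0 \<le> x $ i) \<longrightarrow> 0 \<le> tensor_form m B x)"

definition dual_cone :: "'a::real_inner set \<Rightarrow> 'a set" where
  "dual_cone C = {q. \<forall>v\<in>C. 0 \<le> v \<bullet> q}"

end

(*
  The quantitative part is a Lojasiewicz inequality dist(x, Z) <= C |f x|^c on bounded sets for a
  real polynomial f with zero set Z, proved by induction on the dimension.  Choose a direction v in
  which f is, up to a constant, monic of degree d, and split x = x' + t v.  If |f x| is small, then t
  is close to a complex root w of f(x' + . v), so Im w is small.  If w is not real, then w and its
  conjugate are close and distinct, hence a generalised discriminant, which is a polynomial in x',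
  is small; by the induction hypothesis x' is close to a point where this polynomial has fewer
  distinct roots, and roots move Hoelder continuously.  After at most d such moves the root is real.

  Slack variables x = y^2, A x^(m-1) + a = z^2 turn the solution set into the zero set of one
  polynomial, whose value at a solution of the perturbed problem is quadratic in the perturbation.
  Uniform boundedness comes from normalising unbounded solutions: their limits are nonzero
  l in Sol(A, 0) with <l, a> <= 0, excluded by a in the interior of the dual cone.  The same argument
  applied to variational inequalities truncated to balls (solvable by Brouwer) gives existence.
*)
theory Submission
  imports Defs "HOL-Computational_Algebra.Fundamental_Theorem_Algebra"
begin

section \<open>Polynomial functions along lines\<close>

text \<open>A nearby complex root is not enough: f = s^2 + t^2 has the roots t = i s and t = -i s on
  every line in direction t, but its only real zero is the origin. What detects it is that the two
  roots merge where the discriminant -4 s^2 vanishes, and this is a polynomial in one variable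
  fewer. The ordinary discriminant would not do in general, since it vanishes identically when f has
  a repeated factor; so the number of distinct roots is tracked, with one discriminant for each
  possible number. The roots are chosen at each x' separately, without any continuity in x'. Hence
  only symmetric expressions in them are shown to be polynomial, and root movement is measured by
  evaluating one polynomial at a root of another. The induction runs over subspaces of one fixed
  space, so that the complement of v lives in the same type. Exponents are never computed. For the
  complementarity problem one device serves twice: a solution, and a candidate on a sphere, both
  solve the variational inequality truncated at their own norm, so a single bound yields boundedness
  and existence.\<close>

lemma real_polynomial_function_Lipschitz_on_cball:
  fixes f :: "'a::euclidean_space \<Rightarrow> real"
  assumes "real_polynomial_function f"
  obtains L where "L \<ge> 0" "L-lipschitz_on (cball 0 R) f"
proof -
  \<comment> \<open>The Lipschitz estimate for a product uses bounds on both factors; this supplies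
    them for the multiplication case.\<close>
  have bdd: "\<exists>M\<ge>0. \<forall>x\<in>cball 0 R. \<bar>g x\<bar> \<le> M" if "real_polynomial_function g" for g :: "'a \<Rightarrow> real"
  proof -
    have "continuous_on (cball 0 R) g"
      using that by (simp add: continuous_on_polymonial_function real_polynomial_function_eq)
    then have "bounded (g ` cball 0 R)"
      by (intro compact_imp_bounded compact_continuous_image) auto
    then obtain b where "b > 0" "\<forall>y\<in>g ` cball 0 R. norm y \<le> b"
      unfolding bounded_pos by blast
    then show ?thesis
      by (intro exI[of _ b]) auto
  qed
  have "\<exists>L\<ge>0. L-lipschitz_on (cball 0 R) f"
    using assms
  proof (induction f rule: real_polynomial_function.induct)
    case (linear f)
    show ?case
    proof -
      obtain K where "K \<ge> 0" "\<And>x. norm (f x) \<le> norm x * K"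
        using bounded_linear.nonneg_bounded[OF linear] by blast
      then have "K-lipschitz_on (cball 0 R) f"
        using linear by (intro lipschitz_onI) (simp_all add: dist_norm mult.commute linear_diff[OF bounded_linear.linear[OF linear], symmetric])
      then show ?thesis using \<open>K \<ge> 0\<close> by blast
    qed
  next
    case (const c)
    then show ?case using lipschitz_on_constant by blast
  next
    case (add f g)
    then obtain K L where "K-lipschitz_on (cball 0 R) f" "L-lipschitz_on (cball 0 R) g"
      by blast
    then have "(K + L)-lipschitz_on (cball 0 R) (\<lambda>x. f x + g x)"
      by (rule lipschitz_on_add)
    then show ?case using lipschitz_on_nonneg by blast
  next
    case (mult f g)
    obtain M N where M: "M \<ge> 0" "\<forall>x\<in>cball 0 R. \<bar>f x\<bar> \<le> M"
      and N: "N \<ge> 0" "\<forall>x\<in>cball 0 R. \<bar>g x\<bar> \<le> N"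
      using bdd[OF mult.hyps(1)] bdd[OF mult.hyps(2)] by blast
    obtain K L where K: "K \<ge> 0" "K-lipschitz_on (cball 0 R) f" and L: "L \<ge> 0" "L-lipschitz_on (cball 0 R) g"
      using mult.IH by blast
    have "(K * N + M * L)-lipschitz_on (cball 0 R) (\<lambda>x. f x * g x)"
    proof (rule lipschitz_onI)
      fix u v :: 'a assume uv: "u \<in> cball 0 R" "v \<in> cball 0 R"
      have "\<bar>f u * g u - f v * g v\<bar> = \<bar>(f u - f v) * g u + f v * (g u - g v)\<bar>"
        by (simp add: algebra_simps)
      also have "\<dots> \<le> \<bar>f u - f v\<bar> * \<bar>g u\<bar> + \<bar>f v\<bar> * \<bar>g u - g v\<bar>"
        by (metis abs_mult abs_triangle_ineq)
      also have "\<dots> \<le> (K * dist u v) * N + M * (L * dist u v)"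
        using lipschitz_onD[OF K(2) uv] lipschitz_onD[OF L(2) uv] uv M N K(1) L(1)
        by (intro add_mono mult_mono) (auto simp: dist_real_def)
      finally show "dist (f u * g u) (f v * g v) \<le> (K * N + M * L) * dist u v"
        by (simp add: dist_real_def algebra_simps)
    qed (use K(1) L(1) M(1) N(1) in simp)
    moreover have "K * N + M * L \<ge> 0" using K(1) L(1) M(1) N(1) by simp
    ultimately show ?case by blast
  qed
  then show ?thesis using that by blast
qed

inductive homogeneous_polynomial :: "nat \<Rightarrow> ('a::real_normed_vector \<Rightarrow> real) \<Rightarrow> bool" where
  zero: "homogeneous_polynomial d (\<lambda>x. 0)"
| const: "homogeneous_polynomial 0 (\<lambda>x. c)"
| linear: "bounded_linear f \<Longrightarrow> homogeneous_polynomial 1 f"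
| add: "homogeneous_polynomial d f \<Longrightarrow> homogeneous_polynomial d g \<Longrightarrow>
    homogeneous_polynomial d (\<lambda>x. f x + g x)"
| mult: "homogeneous_polynomial d f \<Longrightarrow> homogeneous_polynomial e g \<Longrightarrow>
    homogeneous_polynomial (d + e) (\<lambda>x. f x * g x)"

lemma homogeneous_polynomial_at_0:
  "homogeneous_polynomial d f \<Longrightarrow> d > 0 \<Longrightarrow> f 0 = 0"
proof (induction rule: homogeneous_polynomial.induct)
  case (linear f)
  then show ?case by (simp add: linear_simps)
qed auto

text \<open>The bounds need not be attained: a formula for the coefficient at the bound, unlike one
  for the leading coefficient, survives factors whose degree drops at some points.\<close>

lemma coeff_mult_degree_bounds:
  fixes p q :: "'a::comm_semiring_0 poly"
  assumes "degree p \<le> d" "degree q \<le> e"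
  shows "coeff (p * q) (d + e) = coeff p d * coeff q e"
proof -
  have "coeff (p * q) (d + e) = (\<Sum>i\<le>d + e. coeff p i * coeff q (d + e - i))"
    by (simp add: coeff_mult)
  also have "\<dots> = (\<Sum>i\<in>{d}. coeff p i * coeff q (d + e - i))"
  proof (rule sum.mono_neutral_right)
    show "\<forall>i\<in>{..d + e} - {d}. coeff p i * coeff q (d + e - i) = 0"
    proof
      fix i assume "i \<in> {..d + e} - {d}"
      then have "i > d \<or> d + e - i > e" by auto
      then show "coeff p i * coeff q (d + e - i) = 0"
        using assms by (auto simp: coeff_eq_0)
    qed
  qed auto
  finally show ?thesis by simp
qed

text \<open>An element of R[x][t], seen as a map that sends x to a polynomial in t.\<close>

definition polynomial_family :: "('a::real_normed_vector \<Rightarrow> real poly) \<Rightarrow> bool" where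
  "polynomial_family P \<longleftrightarrow> (\<forall>k. real_polynomial_function (\<lambda>x. coeff (P x) k))"

lemma polynomial_family_add:
  "polynomial_family P \<Longrightarrow> polynomial_family Q \<Longrightarrow> polynomial_family (\<lambda>x. P x + Q x)"
  by (auto simp: polynomial_family_def)

lemma polynomial_family_sum:
  "finite I \<Longrightarrow> (\<And>i. i \<in> I \<Longrightarrow> polynomial_family (P i)) \<Longrightarrow> polynomial_family (\<lambda>x. \<Sum>i\<in>I. P i x)"
  by (auto simp: polynomial_family_def coeff_sum)

lemma polynomial_family_mult:
  "polynomial_family P \<Longrightarrow> polynomial_family Q \<Longrightarrow> polynomial_family (\<lambda>x. P x * Q x)"
  unfolding polynomial_family_def coeff_mult
  by (intro allI real_polynomial_function_sum real_polynomial_function.intros(4)) auto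

text \<open>In a product of d linear forms, t^d arises only if each factor contributes its term in
  t, so its coefficient cannot depend on x. This is what makes a polynomial monic up to a constant
  along v.\<close>

lemma homogeneous_polynomial_along_line:
  assumes "homogeneous_polynomial d f"
  obtains P where "polynomial_family P" "\<And>x. degree (P x) \<le> d" "\<And>x. coeff (P x) d = f v"
    "\<And>x t. f (x + t *\<^sub>R v) = poly (P x) t"
proof -
  have "\<exists>P. polynomial_family P \<and> (\<forall>x. degree (P x) \<le> d \<and> coeff (P x) d = f v) \<and>
     (\<forall>x t. f (x + t *\<^sub>R v) = poly (P x) t)"
    using assms
  proof (induction rule: homogeneous_polynomial.induct)
    case (zero d)
    then show ?case by (intro exI[of _ "\<lambda>x. 0"]) (auto simp: polynomial_family_def)
  next
    case (const c)
    then show ?case by (intro exI[of _ "\<lambda>x. [:c:]"]) (auto simp: polynomial_family_def coeff_pCons split: nat.split)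
  next
    case (linear f)
    have "coeff [:f x, f v:] k = (if k = 0 then f x else if k = 1 then f v else 0)" for x k
      by (cases k; cases "k - 1") auto
    then have "real_polynomial_function (\<lambda>x. coeff [:f x, f v:] k)" for k
      using linear real_polynomial_function.intros(2)[of 0] real_polynomial_function.intros(2)[of "f v"]
      by (cases "k = 0"; cases "k = 1") (simp_all add: real_polynomial_function.intros)
    then show ?case
      using linear by (intro exI[of _ "\<lambda>x. [:f x, f v:]"]) (auto simp: polynomial_family_def linear_simps)
  next
    case (add d f g)
    then obtain P Q where "polynomial_family P" "\<forall>x. degree (P x) \<le> d \<and> coeff (P x) d = f v"
      "\<forall>x t. f (x + t *\<^sub>R v) = poly (P x) t" "polynomial_family Q" "\<forall>x. degree (Q x) \<le> d \<and> coeff (Q x) d = g v"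
      "\<forall>x t. g (x + t *\<^sub>R v) = poly (Q x) t" by blast
    then show ?case
      by (intro exI[of _ "\<lambda>x. P x + Q x"]) (auto simp: polynomial_family_add degree_add_le)
  next
    case (mult d f e g)
    then obtain P Q where PQ: "polynomial_family P" "\<forall>x. degree (P x) \<le> d \<and> coeff (P x) d = f v"
      "\<forall>x t. f (x + t *\<^sub>R v) = poly (P x) t" "polynomial_family Q" "\<forall>x. degree (Q x) \<le> e \<and> coeff (Q x) e = g v"
      "\<forall>x t. g (x + t *\<^sub>R v) = poly (Q x) t" by blast
    have "degree (P x * Q x) \<le> d + e" for x
      using PQ by (meson add_mono degree_mult_le order_trans)
    with PQ show ?case
      by (intro exI[of _ "\<lambda>x. P x * Q x"]) (auto simp: polynomial_family_mult coeff_mult_degree_bounds)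
  qed
  then show ?thesis using that by metis
qed

text \<open>Finite sums of forms contain all forms and are closed under addition. A product of two
  such sums is a double sum of forms, so closure under addition also settles multiplication, without
  collecting terms of equal degree.\<close>

lemma real_polynomial_function_homogeneous_decomposition:
  assumes "real_polynomial_function f"
  obtains N h where "\<And>j. homogeneous_polynomial j (h j)" "\<And>x. f x = (\<Sum>j\<le>N. h j x)"
proof -
  define S where "S f \<longleftrightarrow> (\<exists>N h. (\<forall>j. homogeneous_polynomial j (h j)) \<and> (\<forall>x. f x = (\<Sum>j\<le>N::nat. h j x)))"
    for f :: "'a \<Rightarrow> real"
  have S_hom: "S f" if "homogeneous_polynomial d f" for d f
    unfolding S_def
  proof (intro exI[of _ d] exI[of _ "\<lambda>j. if j = d then f else (\<lambda>x. 0)"] conjI allI)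
    show "homogeneous_polynomial j (if j = d then f else (\<lambda>x. 0))" for j
      using that by (simp add: homogeneous_polynomial.zero)
    show "f x = (\<Sum>j\<le>d. (if j = d then f else (\<lambda>x. 0)) x)" for x
      by (simp add: if_distribR)
  qed
  have S_add: "S (\<lambda>x. f x + g x)" if "S f" "S g" for f g
  proof -
    obtain N h M k where *: "\<And>j. homogeneous_polynomial j (h j)" "\<And>x. f x = (\<Sum>j\<le>N::nat. h j x)"
       "\<And>j. homogeneous_polynomial j (k j)" "\<And>x. g x = (\<Sum>j\<le>M::nat. k j x)"
      using \<open>S f\<close> \<open>S g\<close> unfolding S_def by blast
    define l where "l j = (\<lambda>x. (if j \<le> N then h j x else 0) + (if j \<le> M then k j x else 0))" for j
    have "homogeneous_polynomial j (l j)" for j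
    proof -
      have "homogeneous_polynomial j (\<lambda>x. if j \<le> N then h j x else 0)"
        by (cases "j \<le> N") (simp_all add: *(1) homogeneous_polynomial.zero)
      moreover have "homogeneous_polynomial j (\<lambda>x. if j \<le> M then k j x else 0)"
        by (cases "j \<le> M") (simp_all add: *(3) homogeneous_polynomial.zero)
      ultimately show ?thesis
        unfolding l_def by (rule homogeneous_polynomial.add)
    qed
    moreover have "f x + g x = (\<Sum>j\<le>max N M. l j x)" for x
    proof -
      have "f x = (\<Sum>j\<le>max N M. if j \<le> N then h j x else 0)"
        unfolding *(2) by (rule sum.mono_neutral_cong_left) auto
      moreover have "g x = (\<Sum>j\<le>max N M. if j \<le> M then k j x else 0)"
        unfolding *(4) by (rule sum.mono_neutral_cong_left) auto
      ultimately show ?thesis by (simp add: l_def sum.distrib)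
    qed
    ultimately show ?thesis unfolding S_def by blast
  qed
  have S_sum: "finite I \<Longrightarrow> (\<And>i. i \<in> I \<Longrightarrow> S (f i)) \<Longrightarrow> S (\<lambda>x. \<Sum>i\<in>I. f i x)" for I :: "nat set" and f
    by (induction I rule: finite_induct) (auto intro!: S_add S_hom[OF homogeneous_polynomial.zero])
  have "S f"
    using assms
  proof (induction rule: real_polynomial_function.induct)
    case (mult f g)
    obtain N h M k where *: "\<And>j. homogeneous_polynomial j (h j)" "\<And>x. f x = (\<Sum>j\<le>N::nat. h j x)"
       "\<And>j. homogeneous_polynomial j (k j)" "\<And>x. g x = (\<Sum>j\<le>M::nat. k j x)"
      using mult.IH unfolding S_def by blast
    have "(\<lambda>x. f x * g x) = (\<lambda>x. \<Sum>i\<le>N. \<Sum>j\<le>M. h i x * k j x)"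
      by (simp add: *(2,4) sum_product)
    moreover have "S (\<lambda>x. \<Sum>i\<le>N. \<Sum>j\<le>M. h i x * k j x)"
      by (intro S_sum S_hom[OF homogeneous_polynomial.mult[OF *(1) *(3)]]) auto
    ultimately show ?case by simp
  qed (auto intro: S_add S_hom[OF homogeneous_polynomial.linear] S_hom[OF homogeneous_polynomial.const])
  then show ?thesis using that unfolding S_def by blast
qed

section \<open>Generalised discriminants of a monic family\<close>

text \<open>Symmetric expressions in complex roots are handled as complex-valued functions; this
  predicate records that such an expression is in fact a real polynomial in x.\<close>

definition real_polynomial_valued :: "('a::real_normed_vector \<Rightarrow> complex) \<Rightarrow> bool" where
  "real_polynomial_valued h \<longleftrightarrow> (\<exists>g. real_polynomial_function g \<and> (\<forall>x. h x = of_real (g x)))"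

lemma real_polynomial_valued_of_real:
  "real_polynomial_function g \<Longrightarrow> real_polynomial_valued (\<lambda>x. of_real (g x))"
  by (auto simp: real_polynomial_valued_def)

lemma real_polynomial_valued_mult:
  assumes "real_polynomial_valued f" "real_polynomial_valued g"
  shows "real_polynomial_valued (\<lambda>x. f x * g x)"
proof -
  obtain f' g' where *: "real_polynomial_function f'" "\<forall>x. f x = of_real (f' x)"
    "real_polynomial_function g'" "\<forall>x. g x = of_real (g' x)"
    using assms unfolding real_polynomial_valued_def by blast
  then show ?thesis
    unfolding real_polynomial_valued_def by (intro exI[of _ "\<lambda>x. f' x * g' x"]) auto
qed

lemma real_polynomial_valued_diff:
  assumes "real_polynomial_valued f" "real_polynomial_valued g"
  shows "real_polynomial_valued (\<lambda>x. f x - g x)"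
proof -
  obtain f' g' where *: "real_polynomial_function f'" "\<forall>x. f x = of_real (f' x)"
    "real_polynomial_function g'" "\<forall>x. g x = of_real (g' x)"
    using assms unfolding real_polynomial_valued_def by blast
  then show ?thesis
    unfolding real_polynomial_valued_def by (intro exI[of _ "\<lambda>x. f' x - g' x"]) auto
qed

lemma real_polynomial_valued_prod:
  assumes "finite I" "\<And>i. i \<in> I \<Longrightarrow> real_polynomial_valued (f i)"
  shows "real_polynomial_valued (\<lambda>x. \<Prod>i\<in>I. f i x)"
  using assms
proof (induction I rule: finite_induct)
  case empty
  show ?case using real_polynomial_valued_of_real[OF real_polynomial_function.intros(2)[of 1]] by simp
next
  case (insert i I)
  then show ?case by (simp add: real_polynomial_valued_mult)
qed

text \<open>For each x, \<open>y x\<close> lists the complex roots of \<open>p x\<close> with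
  multiplicity in an arbitrary order; nothing relates the lists at different points.\<close>

locale monic_family =
  fixes d :: nat and p :: "'a::euclidean_space \<Rightarrow> real poly" and y :: "'a \<Rightarrow> nat \<Rightarrow> complex"
  assumes d_pos: "d > 0"
    and family: "polynomial_family p"
    and factorization: "map_poly of_real (p x) = (\<Prod>i<d. [:- y x i, 1:])"
begin

section \<open>Power sums of the roots are polynomials in x\<close>

definition cofactor :: "'a \<Rightarrow> nat \<Rightarrow> complex poly" where
  "cofactor x i = (\<Prod>l\<in>{..<d} - {i}. [:- y x l, 1:])"

lemma cofactor: "i < d \<Longrightarrow> map_poly of_real (p x) = [:- y x i, 1:] * cofactor x i"
  unfolding factorization cofactor_def by (rule prod.remove) auto

lemma coeff_cofactor_0: "i < d \<Longrightarrow> y x i * coeff (cofactor x i) 0 = - of_real (coeff (p x) 0)"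
  using arg_cong[OF cofactor, of i "\<lambda>q. coeff q 0" x] by (simp add: coeff_map_poly)

lemma coeff_cofactor_Suc:
  "i < d \<Longrightarrow> y x i * coeff (cofactor x i) (Suc k) = coeff (cofactor x i) k - of_real (coeff (p x) (Suc k))"
  using arg_cong[OF cofactor, of i "\<lambda>q. coeff q (Suc k)" x] by (simp add: coeff_map_poly)

lemma coeff_cofactor_top: "i < d \<Longrightarrow> coeff (cofactor x i) (d - 1) = 1"
proof -
  assume "i < d"
  have "degree (cofactor x i) = (\<Sum>l\<in>{..<d} - {i}. degree [:- y x l, 1:])"
    unfolding cofactor_def by (rule degree_prod_eq_sum_degree) auto
  then have "degree (cofactor x i) = d - 1"
    using \<open>i < d\<close> by simp
  moreover have "lead_coeff (cofactor x i) = 1"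
    unfolding cofactor_def lead_coeff_prod by simp
  ultimately show ?thesis by simp
qed

lemma sum_cofactor: "(\<Sum>i<d. cofactor x i) = pderiv (map_poly of_real (p x))"
  unfolding factorization cofactor_def pderiv_prod by (simp add: pderiv_pCons)

text \<open>
  Comparing coefficients in \<open>p = (X - y\<^sub>i) q\<^sub>i\<close> gives a recursion for the sums
  \<open>\<Sum>\<^sub>i y\<^sub>i\<^sup>j coeff q\<^sub>i k\<close>; it starts from \<open>\<Sum>\<^sub>i q\<^sub>i = p'\<close>, and the entry \<open>k = d - 1\<close> is a power sum.
\<close>

lemma real_polynomial_valued_power_sum_cofactor:
  "real_polynomial_valued (\<lambda>x. \<Sum>i<d. y x i ^ j * coeff (cofactor x i) k)"
proof (induction j arbitrary: k)
  case 0
  have "(\<Sum>i<d. y x i ^ 0 * coeff (cofactor x i) k) = of_real (real (Suc k) * coeff (p x) (Suc k))" for x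
    using arg_cong[OF sum_cofactor, of "\<lambda>q. coeff q k" x]
    by (simp add: coeff_sum coeff_pderiv coeff_map_poly)
  moreover have "real_polynomial_function (\<lambda>x. real (Suc k) * coeff (p x) (Suc k))"
    using family unfolding polynomial_family_def
    by (intro real_polynomial_function.intros(4)[OF real_polynomial_function.intros(2)]) auto
  ultimately show ?case
    by (simp only: real_polynomial_valued_of_real)
next
  case (Suc j)
  have coeff: "real_polynomial_valued (\<lambda>x. of_real (coeff (p x) k))" for k
    using family by (simp add: polynomial_family_def real_polynomial_valued_of_real)
  have s: "real_polynomial_valued (\<lambda>x. \<Sum>i<d. y x i ^ j)"
    using Suc.IH[of "d - 1"] by (simp add: coeff_cofactor_top[unfolded One_nat_def] cong: sum.cong_simp)
  show ?case
  proof (cases k)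
    case 0
    have "(\<Sum>i<d. y x i ^ Suc j * coeff (cofactor x i) k) =
       of_real 0 - of_real (coeff (p x) 0) * (\<Sum>i<d. y x i ^ j)" for x
    proof -
      have "(\<Sum>i<d. y x i ^ Suc j * coeff (cofactor x i) k) = (\<Sum>i<d. y x i ^ j * (y x i * coeff (cofactor x i) 0))"
        by (simp add: 0 mult_ac)
      also have "\<dots> = (\<Sum>i<d. y x i ^ j * (- of_real (coeff (p x) 0)))"
        by (intro sum.cong) (auto simp: coeff_cofactor_0)
      finally show ?thesis
        by (simp add: sum_distrib_left mult.commute flip: sum_negf)
    qed
    then show ?thesis
      by (simp only: real_polynomial_valued_diff real_polynomial_valued_mult s coeff
          real_polynomial_valued_of_real real_polynomial_function.intros)
  next
    case (Suc k')
    have "(\<Sum>i<d. y x i ^ Suc j * coeff (cofactor x i) k) =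
       (\<Sum>i<d. y x i ^ j * coeff (cofactor x i) k') - of_real (coeff (p x) k) * (\<Sum>i<d. y x i ^ j)" for x
    proof -
      have "(\<Sum>i<d. y x i ^ Suc j * coeff (cofactor x i) k) =
          (\<Sum>i<d. y x i ^ j * (y x i * coeff (cofactor x i) (Suc k')))"
        by (simp add: Suc mult_ac)
      also have "\<dots> = (\<Sum>i<d. y x i ^ j * (coeff (cofactor x i) k' - of_real (coeff (p x) k)))"
        by (intro sum.cong) (auto simp: coeff_cofactor_Suc Suc)
      finally show ?thesis
        by (simp add: sum_distrib_left right_diff_distrib sum_subtractf mult.commute)
    qed
    then show ?thesis
      by (simp only: real_polynomial_valued_diff real_polynomial_valued_mult s coeff Suc.IH)
  qed
qed

lemma real_polynomial_valued_power_sum: "real_polynomial_valued (\<lambda>x. \<Sum>i<d. y x i ^ j)"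
  using real_polynomial_valued_power_sum_cofactor[of j "d - 1"]
  by (simp add: coeff_cofactor_top[unfolded One_nat_def] cong: sum.cong_simp)

section \<open>Symmetric sums over tuples of roots\<close>

abbreviation tuples :: "nat \<Rightarrow> (nat \<Rightarrow> nat) set" where
  "tuples k \<equiv> {..<k} \<rightarrow>\<^sub>E {..<d}"

lemma finite_tuples: "finite (tuples k)"
  by (intro finite_PiE) auto

text \<open>Multiplying out one difference splits the sum into two of the same kind with one
  exponent raised, which is why \<open>e\<close> is generalised. Once no difference is left, the sum
  over all tuples factors into power sums.\<close>

lemma real_polynomial_valued_tuple_sum:
  assumes "finite I" "I \<subseteq> {..<k} \<times> {..<k}"
  shows "real_polynomial_valued (\<lambda>x. \<Sum>\<tau>\<in>tuples k.
    (\<Prod>(a, b)\<in>I. y x (\<tau> a) - y x (\<tau> b)) * (\<Prod>a<k. y x (\<tau> a) ^ e a))"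
  using assms
proof (induction I arbitrary: e rule: finite_induct)
  case empty
  have "(\<Sum>\<tau>\<in>tuples k. \<Prod>a<k. y x (\<tau> a) ^ e a) = (\<Prod>a<k. \<Sum>i<d. y x i ^ e a)" for x
    by (simp add: prod_sum_PiE)
  then show ?case
    by (simp add: real_polynomial_valued_prod real_polynomial_valued_power_sum)
next
  case (insert ab I)
  obtain a b where [simp]: "ab = (a, b)" by (cases ab)
  have ab: "a < k" "b < k" using insert.prems by auto
  let ?\<phi> = "\<lambda>x \<tau>. \<Prod>(a, b)\<in>I. y x (\<tau> a) - y x (\<tau> b)"
  let ?M = "\<lambda>e x \<tau>. \<Prod>a<k. y x (\<tau> a) ^ e a"
  have mono: "y x (\<tau> c) * ?M e x \<tau> = ?M (e(c := Suc (e c))) x \<tau>" if "c < k" for c x \<tau>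
  proof -
    have "?M (e(c := Suc (e c))) x \<tau> = y x (\<tau> c) ^ Suc (e c) * (\<Prod>a\<in>{..<k} - {c}. y x (\<tau> a) ^ e a)"
      using that by (subst prod.remove[of _ c]) auto
    also have "\<dots> = y x (\<tau> c) * ?M e x \<tau>"
      using that by (subst (2) prod.remove[of _ c]) auto
    finally show ?thesis by simp
  qed
  have "(\<Sum>\<tau>\<in>tuples k. (\<Prod>(a, b)\<in>insert ab I. y x (\<tau> a) - y x (\<tau> b)) * ?M e x \<tau>) =
     (\<Sum>\<tau>\<in>tuples k. ?\<phi> x \<tau> * ?M (e(a := Suc (e a))) x \<tau>) -
     (\<Sum>\<tau>\<in>tuples k. ?\<phi> x \<tau> * ?M (e(b := Suc (e b))) x \<tau>)" for x
    unfolding sum_subtractf[symmetric] mono[OF ab(1), symmetric] mono[OF ab(2), symmetric]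
    using insert.hyps by (intro sum.cong) (auto simp: algebra_simps)
  then show ?case
    using insert.IH insert.prems by (simp only: real_polynomial_valued_diff insert_subset)
qed

section \<open>Distinct roots and generalised discriminants\<close>

definition roots :: "'a \<Rightarrow> complex set" where
  "roots x = y x ` {..<d}"

lemma finite_roots [simp]: "finite (roots x)"
  by (simp add: roots_def)

lemma card_roots_le: "card (roots x) \<le> d"
  unfolding roots_def using card_image_le[of "{..<d}" "y x"] by simp

lemma poly_eq_prod: "poly (map_poly of_real (p x)) z = (\<Prod>i<d. z - y x i)"
  by (simp add: factorization poly_prod)

lemma roots_eq: "roots x = {z. poly (map_poly of_real (p x)) z = 0}"
  by (auto simp: roots_def poly_eq_prod)

lemma roots_nonempty: "roots x \<noteq> {}"
  using d_pos by (auto simp: roots_def)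

lemma cnj_root: "z \<in> roots x \<Longrightarrow> cnj z \<in> roots x"
  unfolding roots_eq mem_Collect_eq
  by (subst real_poly_cnj_root_iff) (auto simp: coeff_map_poly)

text \<open>
  Ordered pairs make each product independent of how the tuple enumerates its values; it differs
  from the usual squared Vandermonde product only by a sign.
\<close>

definition gen_disc :: "nat \<Rightarrow> 'a \<Rightarrow> complex" where
  "gen_disc k x = (\<Sum>\<tau>\<in>tuples k. \<Prod>(a, b)\<in>{(a, b). a < k \<and> b < k \<and> a \<noteq> b}. y x (\<tau> a) - y x (\<tau> b))"

lemma real_polynomial_valued_gen_disc: "real_polynomial_valued (gen_disc k)"
proof -
  have sub: "{(a, b). a < k \<and> b < k \<and> a \<noteq> b} \<subseteq> {..<k} \<times> {..<k}" by auto
  moreover have "finite {(a, b). a < k \<and> b < k \<and> a \<noteq> b}"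
    by (rule finite_subset[OF sub]) auto
  ultimately show ?thesis
    using real_polynomial_valued_tuple_sum[of "{(a, b). a < k \<and> b < k \<and> a \<noteq> b}" k "\<lambda>_. 0"]
    by (simp add: gen_disc_def[abs_def])
qed

lemma tuple_prod_eq_0:
  fixes k :: nat
  assumes "\<not> inj_on (\<lambda>a. y x (\<tau> a)) {..<k}"
  shows "(\<Prod>(a, b)\<in>{(a, b). a < k \<and> b < k \<and> a \<noteq> b}. y x (\<tau> a) - y x (\<tau> b)) = 0"
proof -
  obtain a b where "a < k" "b < k" "a \<noteq> b" "y x (\<tau> a) = y x (\<tau> b)"
    using assms by (auto simp: inj_on_def)
  moreover have "finite {(a, b). a < k \<and> b < k \<and> a \<noteq> b}"
    by (rule finite_subset[of _ "{..<k} \<times> {..<k}"]) auto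
  ultimately show ?thesis
    by (intro prod_zero bexI[of _ "(a, b)"]) auto
qed

lemma gen_disc_eq_0:
  assumes "card (roots x) < k"
  shows "gen_disc k x = 0"
  unfolding gen_disc_def
proof (rule sum.neutral, rule ballI, rule tuple_prod_eq_0)
  fix \<tau> assume "\<tau> \<in> tuples k"
  then have "(\<lambda>a. y x (\<tau> a)) ` {..<k} \<subseteq> roots x"
    by (auto simp: roots_def)
  then show "\<not> inj_on (\<lambda>a. y x (\<tau> a)) {..<k}"
    using assms card_inj_on_le[of "\<lambda>a. y x (\<tau> a)" "{..<k}" "roots x"] by auto
qed

text \<open>Tuples with a repeated value contribute 0, and an injective tuple enumerates all k
  roots. All injective tuples contribute the same product, so nothing can cancel; this relies on k
  being the exact number of distinct roots.\<close>

lemma gen_disc_eq: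
  assumes "card (roots x) = k"
  shows "gen_disc k x = of_nat (card {\<tau> \<in> tuples k. inj_on (\<lambda>a. y x (\<tau> a)) {..<k}}) *
    (\<Prod>(u, v)\<in>{(u, v). u \<in> roots x \<and> v \<in> roots x \<and> u \<noteq> v}. u - v)"
proof -
  have prod_eq: "(\<Prod>(a, b)\<in>{(a, b). a < k \<and> b < k \<and> a \<noteq> b}. y x (\<tau> a) - y x (\<tau> b)) =
    (\<Prod>(u, v)\<in>{(u, v). u \<in> roots x \<and> v \<in> roots x \<and> u \<noteq> v}. u - v)"
    if \<tau>: "\<tau> \<in> tuples k" and inj: "inj_on (\<lambda>a. y x (\<tau> a)) {..<k}" for \<tau>
  proof -
    let ?z = "\<lambda>a. y x (\<tau> a)"
    have "?z ` {..<k} \<subseteq> roots x"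
      using \<tau> by (auto simp: roots_def)
    then have img: "?z ` {..<k} = roots x"
      using assms inj by (intro card_subset_eq) (auto simp: card_image)
    have "bij_betw (\<lambda>(a, b). (?z a, ?z b)) {(a, b). a < k \<and> b < k \<and> a \<noteq> b}
        {(u, v). u \<in> roots x \<and> v \<in> roots x \<and> u \<noteq> v}"
      unfolding bij_betw_def
    proof
      show "inj_on (\<lambda>(a, b). (?z a, ?z b)) {(a, b). a < k \<and> b < k \<and> a \<noteq> b}"
        using inj by (auto simp: inj_on_def)
      show "(\<lambda>(a, b). (?z a, ?z b)) ` {(a, b). a < k \<and> b < k \<and> a \<noteq> b} =
          {(u, v). u \<in> roots x \<and> v \<in> roots x \<and> u \<noteq> v}"
        using inj unfolding img[symmetric] by (auto simp: inj_on_def image_iff)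
    qed
    from prod.reindex_bij_betw[OF this, of "\<lambda>(u, v). u - v"] show ?thesis
      by (simp add: case_prod_unfold)
  qed
  have "gen_disc k x = (\<Sum>\<tau>\<in>{\<tau> \<in> tuples k. inj_on (\<lambda>a. y x (\<tau> a)) {..<k}}.
    \<Prod>(a, b)\<in>{(a, b). a < k \<and> b < k \<and> a \<noteq> b}. y x (\<tau> a) - y x (\<tau> b))"
    unfolding gen_disc_def using finite_tuples tuple_prod_eq_0
    by (intro sum.mono_neutral_right) auto
  then show ?thesis
    by (simp add: prod_eq)
qed

lemma gen_disc_nonzero:
  assumes "card (roots x) = k"
  shows "gen_disc k x \<noteq> 0"
proof -
  obtain f where f: "bij_betw f {..<k} (roots x)"
    using assms ex_bij_betw_nat_finite[OF finite_roots, of x] by (auto simp: atLeast0LessThan)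
  define \<tau> where "\<tau> = restrict (\<lambda>a. inv_into {..<d} (y x) (f a)) {..<k}"
  have *: "f a \<in> y x ` {..<d}" if "a < k" for a
    using f that by (auto simp: bij_betw_def roots_def)
  have "\<tau> \<in> tuples k"
    using * inv_into_into[of _ "y x" "{..<d}"] by (auto simp: \<tau>_def)
  moreover have "inj_on (\<lambda>a. y x (\<tau> a)) {..<k}"
  proof -
    have "y x (\<tau> a) = f a" if "a \<in> {..<k}" for a
      using * that by (simp add: \<tau>_def f_inv_into_f)
    then show ?thesis
      using f by (subst inj_on_cong[where g = f]) (auto simp: bij_betw_def)
  qed
  ultimately have "card {\<tau> \<in> tuples k. inj_on (\<lambda>a. y x (\<tau> a)) {..<k}} \<noteq> 0"
    using finite_tuples by auto
  moreover have "finite {(u, v). u \<in> roots x \<and> v \<in> roots x \<and> u \<noteq> v}"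
    by (rule finite_subset[of _ "roots x \<times> roots x"]) auto
  ultimately show ?thesis
    unfolding gen_disc_eq[OF assms] by (auto simp: prod_zero_iff)
qed

section \<open>Uniform bounds and Hoelder continuity of the roots on balls\<close>

lemma root_bound:
  assumes "z \<in> roots x"
  shows "norm z \<le> 1 + (\<Sum>k<d. \<bar>coeff (p x) k\<bar>)"
proof (cases "norm z \<le> 1")
  case False
  have deg: "degree (map_poly of_real (p x) :: complex poly) = d"
    unfolding factorization by (subst degree_prod_eq_sum_degree) auto
  have lead: "coeff (map_poly of_real (p x)) d = (1 :: complex)"
    using deg lead_coeff_prod[of "\<lambda>i. [:- y x i, 1:]" "{..<d}"] by (simp add: factorization)
  have "(\<Sum>k\<le>d. of_real (coeff (p x) k) * z ^ k) = 0"
    using assms deg by (simp add: roots_eq poly_altdef coeff_map_poly)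
  moreover have "(\<Sum>k\<le>d. of_real (coeff (p x) k) * z ^ k) = (\<Sum>k<d. of_real (coeff (p x) k) * z ^ k) + z ^ d"
    using lead by (simp add: lessThan_Suc_atMost[symmetric] coeff_map_poly)
  ultimately have "z ^ d = - (\<Sum>k<d. of_real (coeff (p x) k) * z ^ k)"
    by (simp add: eq_neg_iff_add_eq_0 add.commute)
  then have "norm z ^ d \<le> (\<Sum>k<d. norm (of_real (coeff (p x) k) * z ^ k))"
    by (metis norm_minus_cancel norm_power norm_sum)
  also have "\<dots> \<le> (\<Sum>k<d. \<bar>coeff (p x) k\<bar> * norm z ^ (d - 1))"
    using False by (intro sum_mono) (auto simp: norm_mult norm_power intro!: mult_left_mono power_increasing)
  also have "\<dots> = (\<Sum>k<d. \<bar>coeff (p x) k\<bar>) * norm z ^ (d - 1)"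
    by (simp add: sum_distrib_right)
  finally have "norm z * norm z ^ (d - 1) \<le> (\<Sum>k<d. \<bar>coeff (p x) k\<bar>) * norm z ^ (d - 1)"
    using d_pos by (simp add: power_eq_if[of _ d])
  moreover have "0 < norm z ^ (d - 1)"
    using False by (intro zero_less_power) linarith
  ultimately have "norm z \<le> (\<Sum>k<d. \<bar>coeff (p x) k\<bar>)"
    by (simp only: mult_le_cancel_right_pos)
  then show ?thesis by simp
qed (auto intro: add_increasing2 sum_nonneg)

lemma roots_bounded:
  obtains M where "M \<ge> 1" "\<And>x z. x \<in> cball 0 R \<Longrightarrow> z \<in> roots x \<Longrightarrow> norm z \<le> M"
proof -
  have "continuous_on (cball 0 R) (\<lambda>x. 1 + (\<Sum>k<d. \<bar>coeff (p x) k\<bar>))"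
    using family unfolding polynomial_family_def
    by (intro continuous_intros continuous_on_polymonial_function) (simp add: real_polynomial_function_eq)
  then have "bounded ((\<lambda>x. 1 + (\<Sum>k<d. \<bar>coeff (p x) k\<bar>)) ` cball 0 R)"
    by (intro compact_imp_bounded compact_continuous_image) auto
  then obtain b where b: "\<forall>x\<in>cball 0 R. norm (1 + (\<Sum>k<d. \<bar>coeff (p x) k\<bar>)) \<le> b"
    unfolding bounded_iff by auto
  have "norm z \<le> max 1 b" if "x \<in> cball 0 R" "z \<in> roots x" for x z
  proof -
    have "norm z \<le> norm (1 + (\<Sum>k<d. \<bar>coeff (p x) k\<bar>))"
      using root_bound[OF that(2)] unfolding real_norm_def by linarith
    also have "\<dots> \<le> b" using b that(1) by blast
    finally show ?thesis by simp
  qed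
  then show ?thesis using that[of "max 1 b"] by auto
qed

text \<open>The discriminant of order k alone may vanish by cancellation at points with more than k
  distinct roots, as for k = 2 and the three cube roots of unity. So the squares of all orders from
  k to d are added. With exactly k distinct roots only the order k survives, and it contains the
  factor u - v.\<close>

lemma root_drop_polynomial:
  obtains G where "real_polynomial_function G" "\<And>x. G x = 0 \<longleftrightarrow> card (roots x) < k"
    "\<And>R. \<exists>C\<ge>0. \<forall>x\<in>cball 0 R. \<forall>u\<in>roots x. \<forall>v\<in>roots x.
       card (roots x) = k \<longrightarrow> u \<noteq> v \<longrightarrow> \<bar>G x\<bar> \<le> C * norm (u - v)"
proof -
  have "\<forall>j. \<exists>g. real_polynomial_function g \<and> (\<forall>x. gen_disc j x = of_real (g x))"
    using real_polynomial_valued_gen_disc unfolding real_polynomial_valued_def by blast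
  then obtain D where D: "\<And>j. real_polynomial_function (D j)" "\<And>j x. gen_disc j x = of_real (D j x)"
    by metis
  define G where "G x = (\<Sum>j=k..d. (D j x)\<^sup>2)" for x
  show thesis
  proof
    show "real_polynomial_function G"
      unfolding G_def[abs_def] using D by (intro real_polynomial_function_sum real_polynomial_function_power) auto
    show "G x = 0 \<longleftrightarrow> card (roots x) < k" for x
    proof
      assume "G x = 0"
      then have "\<forall>j\<in>{k..d}. D j x = 0"
        unfolding G_def by (subst (asm) sum_nonneg_eq_0_iff) auto
      then show "card (roots x) < k"
        using gen_disc_nonzero[of x "card (roots x)"] card_roots_le[of x] D(2) by force
    next
      assume "card (roots x) < k"
      then have "D j x = 0" if "j \<ge> k" for j
        using gen_disc_eq_0[of x j] D(2)[of j x] that by auto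
      then show "G x = 0" by (simp add: G_def)
    qed
    fix R :: real
    obtain M where M: "M \<ge> 1" "\<And>x z. x \<in> cball 0 R \<Longrightarrow> z \<in> roots x \<Longrightarrow> norm z \<le> M"
      using roots_bounded by blast
    define N where "N = card (tuples k)"
    \<comment> \<open>There are at most \<open>k * k\<close> ordered pairs of roots,
      \<open>2 * M\<close> bounds each difference, and \<open>N\<close> bounds the number of
      injective tuples.\<close>
    define B where "B = real N * (2 * M) ^ (k * k)"
    have "B \<ge> 0" using M(1) by (simp add: B_def)
    have "\<bar>G x\<bar> \<le> (B\<^sup>2 * (2 * M)) * norm (u - v)"
      if x: "x \<in> cball 0 R" and uv: "u \<in> roots x" "v \<in> roots x" "u \<noteq> v" and card: "card (roots x) = k" for x u v
    proof -
      let ?P = "{(u, v). u \<in> roots x \<and> v \<in> roots x \<and> u \<noteq> v}"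
      have P: "?P \<subseteq> roots x \<times> roots x" by auto
      have fin: "finite ?P" by (rule finite_subset[OF P]) auto
      have "card (?P - {(u, v)}) \<le> card (roots x \<times> roots x)"
        using P by (intro card_mono) auto
      then have cP: "card (?P - {(u, v)}) \<le> k * k"
        using card by (simp add: card_cartesian_product)
      have le: "norm (a - b) \<le> 2 * M" if "a \<in> roots x" "b \<in> roots x" for a b
        using M(2)[OF x that(1)] M(2)[OF x that(2)] norm_triangle_ineq4[of a b] by linarith
      have "norm (\<Prod>(a, b)\<in>?P. a - b) = norm (u - v) * (\<Prod>(a, b)\<in>?P - {(u, v)}. norm (a - b))"
        using fin uv by (subst prod.remove[of _ "(u, v)"]) (auto simp: norm_mult prod_norm case_prod_unfold)
      also have "(\<Prod>(a, b)\<in>?P - {(u, v)}. norm (a - b)) \<le> (\<Prod>_\<in>?P - {(u, v)}. 2 * M)"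
        using le by (intro prod_mono) auto
      also have "\<dots> = (2 * M) ^ card (?P - {(u, v)})"
        by (rule prod_constant)
      also have "\<dots> \<le> (2 * M) ^ (k * k)"
        using cP M(1) by (intro power_increasing) auto
      finally have "norm (\<Prod>(a, b)\<in>?P. a - b) \<le> norm (u - v) * (2 * M) ^ (k * k)"
        by (simp add: mult_left_mono)
      moreover have "card {\<tau> \<in> tuples k. inj_on (\<lambda>a. y x (\<tau> a)) {..<k}} \<le> N"
        unfolding N_def using finite_tuples by (intro card_mono) auto
      ultimately have "norm (gen_disc k x) \<le> real N * (norm (u - v) * (2 * M) ^ (k * k))"
        unfolding gen_disc_eq[OF card] norm_mult by (intro mult_mono) auto
      then have Dk: "\<bar>D k x\<bar> \<le> B * norm (u - v)"
        by (simp add: D B_def mult_ac)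
      have "k \<le> d" using card card_roots_le[of x] by simp
      have "G x = (\<Sum>j\<in>{k}. (D j x)\<^sup>2)"
        unfolding G_def
      proof (rule sum.mono_neutral_right)
        show "\<forall>j\<in>{k..d} - {k}. (D j x)\<^sup>2 = 0"
          using gen_disc_eq_0[of x] card D(2) by auto
      qed (use \<open>k \<le> d\<close> in auto)
      then have "\<bar>G x\<bar> = \<bar>D k x\<bar>\<^sup>2" by simp
      also have "\<dots> \<le> (B * norm (u - v))\<^sup>2"
        using Dk by (intro power_mono) auto
      also have "\<dots> = B\<^sup>2 * norm (u - v) * norm (u - v)"
        by (simp add: power2_eq_square mult_ac)
      \<comment> \<open>One of the two factors \<open>norm (u - v)\<close> is traded for its bound
        \<open>2 * M\<close>, since a linear estimate is all that is claimed.\<close>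
      also have "\<dots> \<le> B\<^sup>2 * norm (u - v) * (2 * M)"
        using le[OF uv(1,2)] by (intro mult_left_mono) auto
      finally show ?thesis by (simp add: mult_ac)
    qed
    then show "\<exists>C\<ge>0. \<forall>x\<in>cball 0 R. \<forall>u\<in>roots x. \<forall>v\<in>roots x.
       card (roots x) = k \<longrightarrow> u \<noteq> v \<longrightarrow> \<bar>G x\<bar> \<le> C * norm (u - v)"
      using M(1) by (intro exI[of _ "B\<^sup>2 * (2 * M)"]) auto
  qed
qed

text \<open>The absolute value of a monic polynomial at z is the product of the distances from z to
  its roots, and each of them is at least the smallest one.\<close>

lemma exists_root_near:
  obtains i where "i < d" "norm (z - y x i) ^ d \<le> norm (poly (map_poly of_real (p x)) z)"
proof -
  let ?f = "\<lambda>i. norm (z - y x i)"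
  have ne: "?f ` {..<d} \<noteq> {}" using d_pos by auto
  define m where "m = Min (?f ` {..<d})"
  have "m \<in> ?f ` {..<d}" unfolding m_def using ne by (intro Min_in) auto
  then obtain i where i: "i < d" "m = ?f i" by auto
  have "?f i ^ d = (\<Prod>j<d. m)" by (simp add: i)
  also have "\<dots> \<le> (\<Prod>j<d. ?f j)"
  proof (rule prod_mono)
    fix j assume "j \<in> {..<d}"
    then have "m \<le> ?f j"
      unfolding m_def by (intro Min_le) auto
    then show "0 \<le> m \<and> m \<le> ?f j" by (simp add: i(2))
  qed
  also have "\<dots> = norm (poly (map_poly of_real (p x)) z)"
    by (simp add: poly_eq_prod prod_norm)
  finally show ?thesis using that i by blast
qed

text \<open>At a root w of \<open>p x\<close>, the value of \<open>p x'\<close> is the difference of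
  two polynomials whose coefficients are Lipschitz in the point, so the root of \<open>p x'\<close>
  nearest to w is close. Roots are matched one at a time, without a continuous labelling.\<close>

lemma roots_Hoelder:
  obtains L where "L > 0" "\<And>x x' w. x \<in> cball 0 R \<Longrightarrow> x' \<in> cball 0 R \<Longrightarrow> w \<in> roots x \<Longrightarrow>
     \<exists>w'\<in>roots x'. norm (w - w') ^ d \<le> L * norm (x - x')"
proof -
  obtain M where M: "M \<ge> 1" "\<And>x z. x \<in> cball 0 R \<Longrightarrow> z \<in> roots x \<Longrightarrow> norm z \<le> M"
    using roots_bounded by blast
  have "\<forall>k. \<exists>L\<ge>0. L-lipschitz_on (cball 0 R) (\<lambda>x. coeff (p x) k)"
    using family real_polynomial_function_Lipschitz_on_cball unfolding polynomial_family_def by meson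
  then obtain L where L: "\<And>k. L k \<ge> 0" "\<And>k. (L k)-lipschitz_on (cball 0 R) (\<lambda>x. coeff (p x) k)"
    by metis
  define K where "K = (\<Sum>k\<le>d. L k * M ^ k) + 1"
  have "(\<Sum>k\<le>d. L k * M ^ k) \<ge> 0"
    using L(1) M(1) by (intro sum_nonneg) auto
  then have "K > 0" by (simp add: K_def)
  moreover have "\<exists>w'\<in>roots x'. norm (w - w') ^ d \<le> K * norm (x - x')"
    if x: "x \<in> cball 0 R" "x' \<in> cball 0 R" "w \<in> roots x" for x x' w
  proof -
    have deg: "degree (map_poly of_real (p x) :: complex poly) = d" for x
      unfolding factorization by (subst degree_prod_eq_sum_degree) auto
    have P: "poly (map_poly of_real (p x)) w = (\<Sum>k\<le>d. of_real (coeff (p x) k) * w ^ k)" for x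
      by (simp add: poly_altdef deg coeff_map_poly)
    have "poly (map_poly of_real (p x)) w = 0" using x(3) by (simp add: roots_eq)
    then have "poly (map_poly of_real (p x')) w =
        poly (map_poly of_real (p x')) w - poly (map_poly of_real (p x)) w" by simp
    also have "\<dots> = (\<Sum>k\<le>d. of_real (coeff (p x') k - coeff (p x) k) * w ^ k)"
      unfolding P by (simp add: left_diff_distrib sum_subtractf)
    also have "norm \<dots> \<le> (\<Sum>k\<le>d. L k * norm (x - x') * M ^ k)"
    proof (intro sum_norm_le)
      fix k
      have "\<bar>coeff (p x') k - coeff (p x) k\<bar> \<le> L k * norm (x - x')"
        using lipschitz_onD[OF L(2) x(2,1)] by (simp add: dist_norm norm_minus_commute)
      moreover have "norm w ^ k \<le> M ^ k"
        using M(2)[OF x(1,3)] by (intro power_mono) auto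
      ultimately have "\<bar>coeff (p x') k - coeff (p x) k\<bar> * norm w ^ k \<le> L k * norm (x - x') * M ^ k"
        by (intro mult_mono) (auto simp: L(1))
      then show "norm (of_real (coeff (p x') k - coeff (p x) k) * w ^ k) \<le> L k * norm (x - x') * M ^ k"
        by (simp add: norm_mult norm_power del: of_real_diff)
    qed
    also have "\<dots> = (K - 1) * norm (x - x')"
      by (simp add: K_def sum_distrib_left sum_distrib_right mult_ac)
    also have "\<dots> \<le> K * norm (x - x')"
      by (intro mult_right_mono) auto
    finally have "norm (poly (map_poly of_real (p x')) w) \<le> K * norm (x - x')" .
    moreover obtain i where "i < d" "norm (w - y x' i) ^ d \<le> norm (poly (map_poly of_real (p x')) w)"
      using exists_root_near by blast
    ultimately show ?thesis
      by (intro bexI[of _ "y x' i"]) (auto simp: roots_def)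
  qed
  ultimately show ?thesis using that by blast
qed

end

section \<open>The Lojasiewicz inequality\<close>

text \<open>Hoelder-type rates. Hiding both constants lets rates be composed and dominated without
  naming exponents; since \<open>0 powr c = 0\<close>, every rate vanishes at 0.\<close>

definition modulus :: "(real \<Rightarrow> real) \<Rightarrow> bool" where
  "modulus \<phi> \<longleftrightarrow> (\<exists>C>0. \<exists>c>0. \<phi> = (\<lambda>t. C * t powr c))"

lemma modulusI: "C > 0 \<Longrightarrow> c > 0 \<Longrightarrow> modulus (\<lambda>t. C * t powr c)"
  by (auto simp: modulus_def)

lemma modulus_nonneg: "modulus \<phi> \<Longrightarrow> 0 \<le> \<phi> t"
  by (auto simp: modulus_def)

lemma modulus_mono: "modulus \<phi> \<Longrightarrow> 0 \<le> s \<Longrightarrow> s \<le> t \<Longrightarrow> \<phi> s \<le> \<phi> t"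
  by (auto simp: modulus_def intro!: mult_left_mono powr_mono2)

lemma modulus_compose:
  assumes "modulus \<phi>" "modulus \<psi>"
  shows "modulus (\<lambda>t. \<phi> (\<psi> t))"
proof -
  obtain C c C' c' where *: "C > 0" "c > 0" "\<phi> = (\<lambda>t. C * t powr c)" "C' > 0" "c' > 0" "\<psi> = (\<lambda>t. C' * t powr c')"
    using assms unfolding modulus_def by blast
  have "(\<lambda>t. \<phi> (\<psi> t)) = (\<lambda>t. (C * C' powr c) * t powr (c' * c))"
    using * by (simp add: powr_mult powr_powr mult.assoc)
  then show ?thesis
    using * by (simp add: modulusI)
qed

lemma modulus_scale:
  assumes "modulus \<phi>" "K > 0"
  shows "modulus (\<lambda>t. K * \<phi> t)"
proof -
  obtain C c where *: "C > 0" "c > 0" "\<phi> = (\<lambda>t. C * t powr c)"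
    using assms unfolding modulus_def by blast
  then have "(\<lambda>t. K * \<phi> t) = (\<lambda>t. (K * C) * t powr c)"
    by (simp add: mult.assoc)
  then show ?thesis
    using * assms by (simp add: modulusI)
qed

text \<open>A sum of two powers need not be a power, but on [0, 1] the smaller exponent dominates.
  This is the source of several thresholds equal to 1 below.\<close>

lemma modulus_add:
  assumes "modulus \<phi>" "modulus \<psi>"
  obtains \<xi> where "modulus \<xi>" "\<And>t. 0 \<le> t \<Longrightarrow> t \<le> 1 \<Longrightarrow> \<phi> t + \<psi> t \<le> \<xi> t"
proof -
  obtain C c C' c' where *: "C > 0" "c > 0" "\<phi> = (\<lambda>t. C * t powr c)" "C' > 0" "c' > 0" "\<psi> = (\<lambda>t. C' * t powr c')"
    using assms unfolding modulus_def by blast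
  have "\<phi> t + \<psi> t \<le> (C + C') * t powr min c c'" if "0 \<le> t" "t \<le> 1" for t
  proof -
    have "t powr c \<le> t powr min c c'" "t powr c' \<le> t powr min c c'"
      using that by (auto intro: powr_mono')
    then show ?thesis
      using * by (simp add: distrib_right add_mono)
  qed
  then show ?thesis
    using * that[of "\<lambda>t. (C + C') * t powr min c c'"] by (simp add: modulusI)
qed

lemma modulus_small:
  assumes "modulus \<phi>" "\<eta> > 0"
  obtains \<delta> where "\<delta> > 0" "\<And>t. 0 \<le> t \<Longrightarrow> t \<le> \<delta> \<Longrightarrow> \<phi> t \<le> \<eta>"
proof -
  obtain C c where *: "C > 0" "c > 0" "\<phi> = (\<lambda>t. C * t powr c)"
    using assms unfolding modulus_def by blast
  define \<delta> where "\<delta> = (\<eta> / C) powr (1 / c)"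
  have "\<phi> \<delta> = \<eta>"
    using * assms(2) by (simp add: \<delta>_def powr_powr)
  moreover have "\<delta> > 0"
    using * assms(2) by (simp add: \<delta>_def)
  ultimately show ?thesis
    using that[of \<delta>] modulus_mono[OF assms(1), of _ \<delta>] by simp
qed

lemma le_root_powr:
  fixes r s :: real
  assumes "0 \<le> r" "r ^ d \<le> K * s" "d > 0" "K \<ge> 0" "s \<ge> 0"
  shows "r \<le> K powr (1 / d) * s powr (1 / d)"
proof -
  have "r = (r ^ d) powr (1 / d)"
  proof (cases "r = 0")
    case False
    then have "r > 0" using assms(1) by linarith
    then have "(r ^ d) powr (1 / d) = r powr (real d * (1 / d))"
      by (simp only: powr_powr flip: powr_realpow)
    also have "\<dots> = r" using assms(3) \<open>r > 0\<close> by simp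
    finally show ?thesis by simp
  next
    case True
    then show ?thesis using assms(3) by (simp add: zero_power)
  qed
  also have "\<dots> \<le> (K * s) powr (1 / d)"
    using assms by (intro powr_mono2) auto
  finally show ?thesis
    using assms by (simp add: powr_mult)
qed

text \<open>A zero is produced instead of a distance to the zero set, and only where |f x| is below
  a threshold. This also covers an f without zeros in W: the threshold then excludes every point of
  W in the ball. The zero must lie in W but may leave the ball.\<close>

definition lojasiewicz :: "'a::euclidean_space set \<Rightarrow> ('a \<Rightarrow> real) \<Rightarrow> bool" where
  "lojasiewicz W f \<longleftrightarrow> (\<forall>R. \<exists>\<phi> \<delta>. modulus \<phi> \<and> \<delta> > 0 \<and>
    (\<forall>x\<in>W \<inter> cball 0 R. \<bar>f x\<bar> \<le> \<delta> \<longrightarrow> (\<exists>z\<in>W. f z = 0 \<and> norm (x - z) \<le> \<phi> \<bar>f x\<bar>)))"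

text \<open>
  A non-real root comes with its conjugate, so if its imaginary part is small then two distinct
  roots are close and \<open>x\<close> is near the locus with fewer distinct roots.  Moving there displaces the
  root only a little, and with a single distinct root that root is real.
\<close>

lemma (in monic_family) near_real_root:
  assumes "\<And>G. real_polynomial_function G \<Longrightarrow> lojasiewicz W G"
  shows "\<exists>\<xi> \<delta>. modulus \<xi> \<and> \<delta> > 0 \<and> \<delta> \<le> 1 \<and> (\<forall>x\<in>W \<inter> cball 0 R. card (roots x) \<le> k \<longrightarrow>
    (\<forall>w\<in>roots x. \<bar>Im w\<bar> \<le> \<delta> \<longrightarrow> (\<exists>x'\<in>W. \<exists>t. of_real t \<in> roots x' \<and>
       norm (x - x') \<le> \<xi> \<bar>Im w\<bar> \<and> norm (w - of_real t) \<le> \<xi> \<bar>Im w\<bar>)))"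
\<comment> \<open>A move to a point with fewer distinct roots may leave the ball, so the induction
  hypothesis is applied with radius \<open>R + 1\<close>.\<close>
proof (induction k arbitrary: R)
  case 0
  have "\<not> card (roots x) \<le> 0" for x
    using roots_nonempty[of x] by simp
  then show ?case
    using modulusI[of 1 1] by (intro exI[of _ "\<lambda>t. 1 * t powr 1"] exI[of _ 1]) auto
next
  case (Suc k)
  obtain G where G: "real_polynomial_function G" "\<And>x. G x = 0 \<longleftrightarrow> card (roots x) < Suc k"
    and G_bound: "\<And>R. \<exists>C\<ge>0. \<forall>x\<in>cball 0 R. \<forall>u\<in>roots x. \<forall>v\<in>roots x.
       card (roots x) = Suc k \<longrightarrow> u \<noteq> v \<longrightarrow> \<bar>G x\<bar> \<le> C * norm (u - v)"
    using root_drop_polynomial[of "Suc k"] by blast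
  obtain C where C: "C \<ge> 0" "\<And>x u v. x \<in> cball 0 R \<Longrightarrow> u \<in> roots x \<Longrightarrow> v \<in> roots x \<Longrightarrow>
       card (roots x) = Suc k \<Longrightarrow> u \<noteq> v \<Longrightarrow> \<bar>G x\<bar> \<le> C * norm (u - v)"
    using G_bound[of R] by blast
  \<comment> \<open>Conjugate roots differ by 2 |Im w|, which gives the factor \<open>2 * C\<close>;
    the summand 1 makes \<open>K\<close> positive, as a modulus requires.\<close>
  define K where "K = 2 * C + 1"
  have "K > 0" using C(1) by (simp add: K_def)
  obtain \<phi> \<delta>1 where \<phi>: "modulus \<phi>" "\<delta>1 > 0"
    "\<forall>x\<in>W \<inter> cball 0 R. \<bar>G x\<bar> \<le> \<delta>1 \<longrightarrow> (\<exists>z\<in>W. G z = 0 \<and> norm (x - z) \<le> \<phi> \<bar>G x\<bar>)"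
    using assms[OF G(1)] unfolding lojasiewicz_def by blast
  obtain L where L: "L > 0" "\<And>x x' w. x \<in> cball 0 (R + 1) \<Longrightarrow> x' \<in> cball 0 (R + 1) \<Longrightarrow> w \<in> roots x \<Longrightarrow>
     \<exists>w'\<in>roots x'. norm (w - w') ^ d \<le> L * norm (x - x')"
    using roots_Hoelder[of "R + 1"] by blast
  obtain \<xi>0 \<delta>0 where \<xi>0: "modulus \<xi>0" "\<delta>0 > 0" "\<delta>0 \<le> 1"
    and IH: "\<forall>x\<in>W \<inter> cball 0 (R + 1). card (roots x) \<le> k \<longrightarrow> (\<forall>w\<in>roots x. \<bar>Im w\<bar> \<le> \<delta>0 \<longrightarrow>
      (\<exists>x'\<in>W. \<exists>t. of_real t \<in> roots x' \<and> norm (x - x') \<le> \<xi>0 \<bar>Im w\<bar> \<and> norm (w - of_real t) \<le> \<xi>0 \<bar>Im w\<bar>))"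
    using Suc.IH[of "R + 1"] by blast
  have \<xi>0_near: "\<exists>x'\<in>W. \<exists>t. of_real t \<in> roots x' \<and> norm (x - x') \<le> \<xi>0 \<bar>Im w\<bar> \<and> norm (w - of_real t) \<le> \<xi>0 \<bar>Im w\<bar>"
    if "x \<in> W" "x \<in> cball 0 (R + 1)" "card (roots x) \<le> k" "w \<in> roots x" "\<bar>Im w\<bar> \<le> \<delta>0" for x w
    using IH that by blast
  \<comment> \<open>All rates are functions of |Im w|, except that \<open>\<rho>\<close> converts a
    displacement of the point into one of the root. \<open>\<phi>1\<close> bounds the first move,
    \<open>\<sigma>\<close> the imaginary part after it, \<open>\<xi>1\<close> the displacement of
    point and root so far, and \<open>\<xi>\<close> adds the moves from the induction hypothesis.
    The identity is written \<open>1 * t powr 1\<close> to have the shape of a modulus.\<close>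
  define \<rho> where "\<rho> t = L powr (1 / d) * t powr (1 / d)" for t
  have \<rho>: "modulus \<rho>"
    unfolding \<rho>_def[abs_def] using L(1) d_pos by (intro modulusI) auto
  define \<phi>1 where "\<phi>1 t = \<phi> (K * t powr 1)" for t
  have \<phi>1: "modulus \<phi>1"
    unfolding \<phi>1_def[abs_def] using \<open>K > 0\<close> by (rule modulus_compose[OF \<phi>(1) modulusI]) simp
  have \<rho>\<phi>1: "modulus (\<lambda>t. \<rho> (\<phi>1 t))"
    by (rule modulus_compose[OF \<rho> \<phi>1])
  obtain \<sigma> where \<sigma>: "modulus \<sigma>" "\<And>t. 0 \<le> t \<Longrightarrow> t \<le> 1 \<Longrightarrow> 1 * t powr 1 + \<rho> (\<phi>1 t) \<le> \<sigma> t"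
    using modulus_add[OF modulusI[of 1 1] \<rho>\<phi>1] by auto
  obtain \<xi>1 where \<xi>1: "modulus \<xi>1" "\<And>t. 0 \<le> t \<Longrightarrow> t \<le> 1 \<Longrightarrow> \<phi>1 t + \<rho> (\<phi>1 t) \<le> \<xi>1 t"
    using modulus_add[OF \<phi>1 \<rho>\<phi>1] by auto
  obtain \<xi> where \<xi>: "modulus \<xi>" "\<And>t. 0 \<le> t \<Longrightarrow> t \<le> 1 \<Longrightarrow> \<xi>1 t + \<xi>0 (\<sigma> t) \<le> \<xi> t"
    using modulus_add[OF \<xi>1(1) modulus_compose[OF \<xi>0(1) \<sigma>(1)]] by auto
  obtain \<delta>2 where \<delta>2: "\<delta>2 > 0" "\<And>t. 0 \<le> t \<Longrightarrow> t \<le> \<delta>2 \<Longrightarrow> \<phi>1 t \<le> 1"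
    using modulus_small[OF \<phi>1, of 1] by auto
  obtain \<delta>3 where \<delta>3: "\<delta>3 > 0" "\<And>t. 0 \<le> t \<Longrightarrow> t \<le> \<delta>3 \<Longrightarrow> \<sigma> t \<le> \<delta>0"
    using modulus_small[OF \<sigma>(1) \<xi>0(2)] by auto
  \<comment> \<open>1 admits sums of moduli, \<open>\<delta>0\<close> the induction hypothesis at x
    itself, \<open>\<delta>1 / K\<close> makes \<open>G x\<close> small enough to move,
    \<open>\<delta>2\<close> keeps the new point in the larger ball, and \<open>\<delta>3\<close>
    admits the induction hypothesis at the new root.\<close>
  define \<delta> where "\<delta> = Min {1, \<delta>0, \<delta>1 / K, \<delta>2, \<delta>3}"
  have \<delta>: "\<delta> > 0" "\<delta> \<le> 1" "\<delta> \<le> \<delta>0" "\<delta> \<le> \<delta>1 / K" "\<delta> \<le> \<delta>2" "\<delta> \<le> \<delta>3"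
    using \<xi>0 \<phi> \<delta>2 \<delta>3 \<open>K > 0\<close> by (auto simp: \<delta>_def)
  have "\<exists>x'\<in>W. \<exists>t. of_real t \<in> roots x' \<and> norm (x - x') \<le> \<xi> \<bar>Im w\<bar> \<and> norm (w - of_real t) \<le> \<xi> \<bar>Im w\<bar>"
    if x: "x \<in> W" "x \<in> cball 0 R" and card: "card (roots x) \<le> Suc k" and w: "w \<in> roots x" "\<bar>Im w\<bar> \<le> \<delta>" for x w
  proof -
    define \<tau> where "\<tau> = \<bar>Im w\<bar>"
    have \<tau>: "0 \<le> \<tau>" "\<tau> \<le> 1" "\<tau> \<le> \<delta>"
      using w(2) \<delta>(2) by (auto simp: \<tau>_def)
    have \<tau>_le: "\<tau> + \<rho> (\<phi>1 \<tau>) \<le> \<sigma> \<tau>"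
      using \<sigma>(2)[OF \<tau>(1,2)] \<tau>(1) by simp
    have \<xi>_le: "\<phi>1 \<tau> + \<rho> (\<phi>1 \<tau>) + \<xi>0 (\<sigma> \<tau>) \<le> \<xi> \<tau>"
      using \<xi>(2)[OF \<tau>(1,2)] \<xi>1(2)[OF \<tau>(1,2)] by simp
    have nonneg: "0 \<le> \<phi>1 \<tau>" "0 \<le> \<rho> (\<phi>1 \<tau>)"
      using modulus_nonneg \<phi>1 \<rho> by auto
    consider "card (roots x) \<le> k" | "Im w = 0" | "card (roots x) = Suc k" "Im w \<noteq> 0"
      using card by linarith
    then show ?thesis
    proof cases
      case 1
      then have "\<exists>x'\<in>W. \<exists>t. of_real t \<in> roots x' \<and> norm (x - x') \<le> \<xi>0 \<tau> \<and> norm (w - of_real t) \<le> \<xi>0 \<tau>"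
        unfolding \<tau>_def using x w \<delta>(3) by (intro \<xi>0_near) auto
      moreover have "\<xi>0 \<tau> \<le> \<xi>0 (\<sigma> \<tau>)"
        using \<tau>_le nonneg \<tau>(1) by (intro modulus_mono[OF \<xi>0(1)]) auto
      then have "\<xi>0 \<tau> \<le> \<xi> \<tau>"
        using \<xi>_le nonneg by linarith
      ultimately show ?thesis
        unfolding \<tau>_def by (meson order_trans)
    next
      case 2
      then have "of_real (Re w) = w"
        by (simp add: complex_eq_iff)
      then show ?thesis
        using x(1) w(1) modulus_nonneg[OF \<xi>(1)] by (intro bexI[of _ x] exI[of _ "Re w"]) auto
    next
      case 3
      have "w \<noteq> cnj w" using 3(2) by (simp add: complex_eq_iff)
      then have "\<bar>G x\<bar> \<le> C * norm (w - cnj w)"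
        using C(2)[OF x(2) w(1) cnj_root[OF w(1)] 3(1)] by blast
      also have "w - cnj w = of_real (2 * Im w) * \<i>"
        by (simp add: complex_eq_iff)
      also have "C * norm (of_real (2 * Im w) * \<i>) = 2 * C * \<tau>"
        by (simp add: norm_mult \<tau>_def abs_mult)
      also have "\<dots> \<le> K * \<tau>"
        using \<tau>(1) by (simp add: K_def algebra_simps)
      finally have Gx: "\<bar>G x\<bar> \<le> K * \<tau>" .
      also have "\<dots> \<le> \<delta>1"
        using mult_left_mono[of \<tau> "\<delta>1 / K" K] \<tau>(3) \<delta>(4) \<open>K > 0\<close> by simp
      finally obtain x1 where x1: "x1 \<in> W" "G x1 = 0" "norm (x - x1) \<le> \<phi> \<bar>G x\<bar>"
        using \<phi>(3) x by blast
      note x1(3)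
      also have "\<phi> \<bar>G x\<bar> \<le> \<phi>1 \<tau>"
        unfolding \<phi>1_def using Gx \<tau>(1) by (intro modulus_mono[OF \<phi>(1)]) auto
      finally have x1_near: "norm (x - x1) \<le> \<phi>1 \<tau>" .
      also have "\<phi>1 \<tau> \<le> 1"
        using \<delta>2(2) \<tau> \<delta>(5) by simp
      finally have "x1 \<in> cball 0 (R + 1)"
        using x(2) norm_triangle_ineq2[of x1 x] by (simp add: norm_minus_commute)
      moreover have "x \<in> cball 0 (R + 1)" using x(2) by simp
      ultimately obtain w1 where w1: "w1 \<in> roots x1" "norm (w - w1) ^ d \<le> L * norm (x - x1)"
        using L(2) w(1) by blast
      have "norm (w - w1) \<le> \<rho> (norm (x - x1))"
        unfolding \<rho>_def using w1(2) d_pos L(1) by (intro le_root_powr) auto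
      also have "\<dots> \<le> \<rho> (\<phi>1 \<tau>)"
        using x1_near by (intro modulus_mono[OF \<rho>]) auto
      finally have w1_near: "norm (w - w1) \<le> \<rho> (\<phi>1 \<tau>)" .
      have "\<bar>Im w1\<bar> \<le> \<tau> + norm (w - w1)"
        using abs_Im_le_cmod[of "w - w1"] by (auto simp: \<tau>_def)
      with w1_near \<tau>_le have Im_w1: "\<bar>Im w1\<bar> \<le> \<sigma> \<tau>" by linarith
      also have "\<sigma> \<tau> \<le> \<delta>0"
        using \<delta>3(2) \<tau> \<delta>(6) by simp
      finally have "\<bar>Im w1\<bar> \<le> \<delta>0" .
      moreover have "card (roots x1) \<le> k"
        using G(2)[of x1] x1(2) by simp
      ultimately obtain x2 t where x2: "x2 \<in> W" "of_real t \<in> roots x2"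
        "norm (x1 - x2) \<le> \<xi>0 \<bar>Im w1\<bar>" "norm (w1 - of_real t) \<le> \<xi>0 \<bar>Im w1\<bar>"
        using \<xi>0_near[OF x1(1) \<open>x1 \<in> cball 0 (R + 1)\<close> _ w1(1)] by blast
      have "\<xi>0 \<bar>Im w1\<bar> \<le> \<xi>0 (\<sigma> \<tau>)"
        using Im_w1 by (intro modulus_mono[OF \<xi>0(1)]) auto
      then have "norm (x - x2) \<le> \<xi> \<tau>" "norm (w - of_real t) \<le> \<xi> \<tau>"
        using \<xi>_le nonneg x2(3,4) x1_near w1_near norm_triangle_ineq[of "x - x1" "x1 - x2"]
          norm_triangle_ineq[of "w - w1" "w1 - of_real t"] by simp_all
      then show ?thesis
        unfolding \<tau>_def using x2(1,2) by blast
    qed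
  qed
  then show ?case
    using \<xi>(1) \<delta>(1,2) by (intro exI[of _ \<xi>] exI[of _ \<delta>]) auto
qed

section \<open>Induction on the dimension of the subspace\<close>

lemma monic_complex_poly_factorization:
  fixes q :: "complex poly"
  assumes "degree q = d" "lead_coeff q = 1"
  obtains y where "q = (\<Prod>i<d. [:- y i, 1:])"
proof -
  obtain A where A: "size A = d" "q = (\<Prod>x\<in>#A. [:- x, 1:])"
    using alg_closed_imp_factorization[of q] assms by force
  obtain xs where xs: "mset xs = A" using ex_mset by blast
  have "q = prod_list (map (\<lambda>x. [:- x, 1:]) xs)"
    using A(2) unfolding xs[symmetric] by (metis mset_map prod_mset_prod_list)
  also have "\<dots> = (\<Prod>i<d. [:- (xs ! i), 1:])"
    using A(1) xs by (auto simp: prod.list_conv_set_nth atLeast0LessThan)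
  finally show ?thesis using that by blast
qed

text \<open>Only degrees visible on W count: d is the largest degree whose form does not vanish
  identically on W. A vector v of W on which this form is nonzero makes the leading coefficient of f
  along v the constant \<open>h d v\<close> at all points of W.\<close>

lemma lojasiewicz_step:
  fixes W :: "'a::euclidean_space set"
  assumes "subspace W" "real_polynomial_function f"
    and IH: "\<And>(W' :: 'a set) G. subspace W' \<Longrightarrow> dim W' < dim W \<Longrightarrow> real_polynomial_function G \<Longrightarrow> lojasiewicz W' G"
  shows "lojasiewicz W f"
proof -
  obtain N h where h: "\<And>j. homogeneous_polynomial j (h j)" "\<And>x. f x = (\<Sum>j\<le>N. h j x)"
    using real_polynomial_function_homogeneous_decomposition[OF assms(2)] by metis
  define J where "J = {j. j \<le> N \<and> (\<exists>x\<in>W. h j x \<noteq> 0)}"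
  have "finite J" by (simp add: J_def)
  show ?thesis
  proof (cases "J = {}")
    case True
    then have "f x = 0" if "x \<in> W" for x
      using that by (auto simp: J_def h(2))
    then show ?thesis
      unfolding lojasiewicz_def using modulusI[of 1 1]
      by (intro allI exI[of _ "\<lambda>t. 1 * t powr 1"] exI[of _ 1]) auto
  next
    case False
    define d where "d = Max J"
    have "d \<in> J" unfolding d_def using False \<open>finite J\<close> by simp
    then obtain v where v: "v \<in> W" "h d v \<noteq> 0" and "d \<le> N"
      by (auto simp: J_def)
    have fW: "f x = (\<Sum>j\<le>d. h j x)" if "x \<in> W" for x
      unfolding h(2)
    proof (rule sum.mono_neutral_right)
      show "\<forall>j\<in>{..N} - {..d}. h j x = 0"
      proof
        fix j assume "j \<in> {..N} - {..d}"
        then have "j \<notin> J" using \<open>finite J\<close> Max_ge[of J j] by (auto simp: d_def)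
        then show "h j x = 0" using \<open>j \<in> {..N} - {..d}\<close> that by (auto simp: J_def)
      qed
    qed (use \<open>d \<le> N\<close> in auto)
    have "\<forall>j. \<exists>P. polynomial_family P \<and> (\<forall>x. degree (P x) \<le> j \<and> coeff (P x) j = h j v) \<and>
      (\<forall>x t. h j (x + t *\<^sub>R v) = poly (P x) t)"
      using homogeneous_polynomial_along_line[OF h(1)] by metis
    then obtain P where P: "\<And>j. polynomial_family (P j)" "\<And>j x. degree (P j x) \<le> j"
      "\<And>j x. coeff (P j x) j = h j v" "\<And>j x t. h j (x + t *\<^sub>R v) = poly (P j x) t"
      by metis
    define Q where "Q x = (\<Sum>j\<le>d. P j x)" for x
    have degQ: "degree (Q x) \<le> d" for x
      unfolding Q_def using P(2) by (intro degree_sum_le) (auto intro: order_trans)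
    have coeffQ: "coeff (Q x) d = h d v" for x
    proof -
      have "coeff (Q x) d = (\<Sum>j\<in>{d}. coeff (P j x) d)"
        unfolding Q_def coeff_sum
      proof (rule sum.mono_neutral_right)
        show "\<forall>j\<in>{..d} - {d}. coeff (P j x) d = 0"
          using P(2) by (auto intro!: coeff_eq_0 intro: le_less_trans[OF P(2)])
      qed auto
      then show ?thesis by (simp add: P(3))
    qed
    have Q: "f (x + t *\<^sub>R v) = poly (Q x) t" if "x \<in> W" for x t
    proof -
      have "x + t *\<^sub>R v \<in> W"
        using \<open>subspace W\<close> that v(1) by (simp add: subspace_add subspace_scale)
      then show ?thesis by (simp add: fW P(4) Q_def poly_sum)
    qed
    define a where "a = h d v"
    have "a \<noteq> 0" using v(2) by (simp add: a_def)
    show ?thesis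
    \<comment> \<open>If d = 0, then f is a nonzero constant on W, and half its absolute value as
      threshold makes the claim vacuous.\<close>
    proof (cases "d = 0")
      case True
      have "\<bar>f x\<bar> = \<bar>a\<bar>" if "x \<in> W" for x
      proof -
        have "degree (Q x) = 0" using degQ[of x] True by simp
        then have "poly (Q x) 0 = a"
          using coeffQ[of x] True by (simp add: a_def poly_0_coeff_0)
        then show ?thesis using Q[OF that, of 0] by simp
      qed
      then show ?thesis
        unfolding lojasiewicz_def using modulusI[of 1 1] \<open>a \<noteq> 0\<close>
        by (intro allI exI[of _ "\<lambda>t. 1 * t powr 1"] exI[of _ "\<bar>a\<bar> / 2"]) auto
    next
      case False
      then have "d > 0" by simp
      have "v \<noteq> 0"
        using homogeneous_polynomial_at_0[OF h(1) \<open>d > 0\<close>] v(2) by auto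
      define p where "p x = smult (1 / a) (Q x)" for x
      have deg_p: "degree (map_poly of_real (p x) :: complex poly) = d" for x
      proof -
        have "degree (Q x) = d"
          using degQ[of x] coeffQ[of x] v(2) le_degree[of "Q x" d] by simp
        then have "degree (p x) = d" using \<open>a \<noteq> 0\<close> by (simp add: p_def)
        then show ?thesis by (simp add: degree_map_poly)
      qed
      have lead_p: "lead_coeff (map_poly of_real (p x) :: complex poly) = 1" for x
        unfolding deg_p using coeffQ[of x] \<open>a \<noteq> 0\<close> by (simp add: coeff_map_poly p_def flip: a_def)
      have "\<forall>x. \<exists>y. map_poly of_real (p x) = (\<Prod>i<d. [:- y i, 1 :: complex:])"
        using monic_complex_poly_factorization[OF deg_p lead_p] by metis
      then obtain y where y: "\<And>x. map_poly of_real (p x) = (\<Prod>i<d. [:- y x i, 1 :: complex:])"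
        by metis
      have "polynomial_family Q"
        unfolding Q_def[abs_def] using P(1) by (intro polynomial_family_sum) auto
      then have "polynomial_family p"
        unfolding polynomial_family_def p_def coeff_smult
        by (intro allI real_polynomial_function.intros(4)[OF real_polynomial_function.intros(2)]) auto
      then interpret monic_family d p y
        by (rule monic_family.intro[OF \<open>d > 0\<close> _ y])
      have poly_p: "poly (map_poly of_real (p x)) (of_real t) = (of_real (f (x + t *\<^sub>R v) / a) :: complex)"
        if "x \<in> W" for x t
        using Q[OF that] by (simp add: p_def poly_altdef coeff_map_poly degree_map_poly sum_divide_distrib)
      define W' where "W' = {w \<in> W. \<forall>u\<in>span {v}. orthogonal u w}"
      have W'_iff: "w \<in> W' \<longleftrightarrow> w \<in> W \<and> v \<bullet> w = 0" for w
        unfolding W'_def by (auto simp: orthogonal_def span_singleton)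
      have "subspace W'"
        using \<open>subspace W\<close> by (auto simp: subspace_def W'_iff inner_simps)
      have "span {v} \<subseteq> W"
        using v(1) \<open>subspace W\<close> by (intro span_minimal) auto
      then have "dim W' + dim (span {v}) = dim W"
        unfolding W'_def using \<open>subspace W\<close> by (intro dim_subspace_orthogonal_to_vectors) auto
      then have "dim W' < dim W" using \<open>v \<noteq> 0\<close> by simp
      show ?thesis
        unfolding lojasiewicz_def
      proof
        fix R :: real
        \<comment> \<open>The component of x orthogonal to v is estimated by the triangle
          inequality, hence the radius \<open>2 * R\<close>.\<close>
        obtain \<xi> \<delta> where \<xi>: "modulus \<xi>" "\<delta> > 0"
          and near': "\<forall>x\<in>W' \<inter> cball 0 (2 * R). card (roots x) \<le> d \<longrightarrow>
            (\<forall>w\<in>roots x. \<bar>Im w\<bar> \<le> \<delta> \<longrightarrow> (\<exists>x'\<in>W'. \<exists>t. of_real t \<in> roots x' \<and>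
             norm (x - x') \<le> \<xi> \<bar>Im w\<bar> \<and> norm (w - of_real t) \<le> \<xi> \<bar>Im w\<bar>))"
          using near_real_root[OF IH[OF \<open>subspace W'\<close> \<open>dim W' < dim W\<close>], where R = "2 * R" and k = d]
          by blast
        have near: "\<exists>x'\<in>W'. \<exists>t. of_real t \<in> roots x' \<and>
             norm (x - x') \<le> \<xi> \<bar>Im w\<bar> \<and> norm (w - of_real t) \<le> \<xi> \<bar>Im w\<bar>"
          if "x \<in> W'" "x \<in> cball 0 (2 * R)" "w \<in> roots x" "\<bar>Im w\<bar> \<le> \<delta>" for x w
          using near' that card_roots_le[of x] by blast
        \<comment> \<open>\<open>\<kappa>\<close> bounds the distance from the real parameter t to
          the nearest root, hence also the imaginary part of that root; the factor 1 / |a| comes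
          from making f monic. \<open>\<psi>\<close> will bound the change of the parameter and
          \<open>\<theta>\<close> the displacement of x.\<close>
        define \<kappa> where "\<kappa> s = (1 / \<bar>a\<bar>) powr (1 / d) * s powr (1 / d)" for s
        have \<kappa>: "modulus \<kappa>"
          unfolding \<kappa>_def[abs_def] using \<open>a \<noteq> 0\<close> \<open>d > 0\<close> by (intro modulusI) auto
        obtain \<delta>1 where \<delta>1: "\<delta>1 > 0" "\<And>t. 0 \<le> t \<Longrightarrow> t \<le> \<delta>1 \<Longrightarrow> \<kappa> t \<le> \<delta>"
          using modulus_small[OF \<kappa> \<xi>(2)] by auto
        have \<xi>\<kappa>: "modulus (\<lambda>s. \<xi> (\<kappa> s))"
          by (rule modulus_compose[OF \<xi>(1) \<kappa>])
        obtain \<psi> where \<psi>: "modulus \<psi>" "\<And>s. 0 \<le> s \<Longrightarrow> s \<le> 1 \<Longrightarrow> \<xi> (\<kappa> s) + \<kappa> s \<le> \<psi> s"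
          using modulus_add[OF \<xi>\<kappa> \<kappa>] by auto
        have "norm v > 0" using \<open>v \<noteq> 0\<close> by simp
        obtain \<theta> where \<theta>: "modulus \<theta>" "\<And>s. 0 \<le> s \<Longrightarrow> s \<le> 1 \<Longrightarrow> \<xi> (\<kappa> s) + norm v * \<psi> s \<le> \<theta> s"
          using modulus_add[OF \<xi>\<kappa> modulus_scale[OF \<psi>(1) \<open>norm v > 0\<close>]] by auto
        have "\<exists>z\<in>W. f z = 0 \<and> norm (x - z) \<le> \<theta> \<bar>f x\<bar>"
          if x: "x \<in> W" "x \<in> cball 0 R" and fx: "\<bar>f x\<bar> \<le> min 1 \<delta>1" for x
        proof -
          define t where "t = (v \<bullet> x) / (v \<bullet> v)"
          define x0 where "x0 = x - t *\<^sub>R v"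
          have x_eq: "x = x0 + t *\<^sub>R v" by (simp add: x0_def)
          have "x0 \<in> W'"
            using \<open>subspace W\<close> x(1) v(1) \<open>v \<noteq> 0\<close>
            by (auto simp: W'_iff x0_def t_def subspace_diff subspace_scale inner_diff_right)
          then have "x0 \<in> W" by (simp add: W'_iff)
          have "\<bar>t\<bar> * norm v \<le> norm x"
            using Cauchy_Schwarz_ineq2[of v x] \<open>norm v > 0\<close>
            by (simp add: t_def dot_square_norm power2_eq_square field_simps)
          then have "norm x0 \<le> 2 * R"
            using x(2) norm_triangle_ineq4[of x "t *\<^sub>R v"] by (simp add: x0_def)
          then have x0_ball: "x0 \<in> cball 0 (2 * R)" by simp
          obtain i where i: "i < d" "norm (of_real t - y x0 i) ^ d \<le> norm (poly (map_poly of_real (p x0)) (of_real t :: complex))"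
            using exists_root_near by blast
          define w where "w = y x0 i"
          have w: "w \<in> roots x0" using i(1) by (auto simp: roots_def w_def)
          have "norm (of_real t - w) ^ d \<le> (1 / \<bar>a\<bar>) * \<bar>f x\<bar>"
            using i(2) unfolding poly_p[OF \<open>x0 \<in> W\<close>] x_eq[symmetric] w_def
            by (simp add: norm_divide del: of_real_divide flip: of_real_divide)
          then have tw: "norm (of_real t - w) \<le> \<kappa> \<bar>f x\<bar>"
            unfolding \<kappa>_def using \<open>d > 0\<close> by (intro le_root_powr) auto
          have Im_w: "\<bar>Im w\<bar> \<le> \<kappa> \<bar>f x\<bar>"
            using abs_Im_le_cmod[of "of_real t - w"] tw by simp
          also have "\<dots> \<le> \<delta>"
            using \<delta>1(2) fx by simp
          finally obtain x1 s where x1: "x1 \<in> W'" "of_real s \<in> roots x1" "norm (x0 - x1) \<le> \<xi> \<bar>Im w\<bar>"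
            "norm (w - of_real s) \<le> \<xi> \<bar>Im w\<bar>"
            using near[OF \<open>x0 \<in> W'\<close> x0_ball w] by blast
          have "\<xi> \<bar>Im w\<bar> \<le> \<xi> (\<kappa> \<bar>f x\<bar>)"
            using Im_w by (intro modulus_mono[OF \<xi>(1)]) auto
          then have x01: "norm (x0 - x1) \<le> \<xi> (\<kappa> \<bar>f x\<bar>)" and "norm (w - of_real s) \<le> \<xi> (\<kappa> \<bar>f x\<bar>)"
            using x1 by linarith+
          then have "norm (of_real t - of_real s :: complex) \<le> \<psi> \<bar>f x\<bar>"
            using tw \<psi>(2)[of "\<bar>f x\<bar>"] fx norm_triangle_ineq[of "of_real t - w" "w - of_real s"] by simp
          then have ts: "\<bar>t - s\<bar> \<le> \<psi> \<bar>f x\<bar>"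
            by (metis norm_of_real of_real_diff)
          define z where "z = x1 + s *\<^sub>R v"
          have "x1 \<in> W" using x1(1) by (simp add: W'_iff)
          then have "z \<in> W"
            using \<open>subspace W\<close> v(1) by (simp add: z_def subspace_add subspace_scale)
          moreover have "f z = 0"
            using x1(2) \<open>a \<noteq> 0\<close> unfolding roots_eq by (simp add: poly_p[OF \<open>x1 \<in> W\<close>] z_def)
          moreover have "norm (x - z) \<le> \<theta> \<bar>f x\<bar>"
          proof -
            have "x - z = (x0 - x1) + (t - s) *\<^sub>R v"
              by (simp add: x_eq z_def algebra_simps)
            then have "norm (x - z) \<le> norm (x0 - x1) + \<bar>t - s\<bar> * norm v"
              by (metis norm_scaleR norm_triangle_ineq)
            also have "\<dots> \<le> \<xi> (\<kappa> \<bar>f x\<bar>) + norm v * \<psi> \<bar>f x\<bar>"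
              using x01 mult_right_mono[OF ts, of "norm v"] by (simp add: mult.commute)
            also have "\<dots> \<le> \<theta> \<bar>f x\<bar>"
              using \<theta>(2)[of "\<bar>f x\<bar>"] fx by simp
            finally show ?thesis .
          qed
          ultimately show ?thesis by blast
        qed
        then show "\<exists>\<phi> \<delta>. modulus \<phi> \<and> 0 < \<delta> \<and> (\<forall>x\<in>W \<inter> cball 0 R. \<bar>f x\<bar> \<le> \<delta> \<longrightarrow>
          (\<exists>z\<in>W. f z = 0 \<and> norm (x - z) \<le> \<phi> \<bar>f x\<bar>))"
          using \<theta>(1) \<delta>1(1) by (intro exI[of _ \<theta>] exI[of _ "min 1 \<delta>1"]) auto
      qed
    qed
  qed
qed

text \<open>The base of the induction is contained in the step: on W = {0} no form of positive
  degree is nonzero, so the case that appeals to smaller subspaces cannot arise.\<close>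

theorem lojasiewicz_inequality:
  fixes W :: "'a::euclidean_space set"
  assumes "subspace W" "real_polynomial_function f"
  shows "lojasiewicz W f"
  using assms
proof (induction "dim W" arbitrary: W f rule: less_induct)
  case less
  show ?case
    by (rule lojasiewicz_step[OF less.prems]) (rule less.hyps)
qed

section \<open>Tensor complementarity problems\<close>

lemma finite_multi_indices [simp]: "finite {js :: 'n::finite list. length js = k}"
  using finite_lists_length_eq[of "UNIV :: 'n set" k] by simp

lemma abs_monomial_le:
  fixes x :: "real ^ 'n"
  assumes "norm x \<le> R"
  shows "\<bar>\<Prod>j\<leftarrow>js. x $ j\<bar> \<le> R ^ length js"
proof (induction js)
  case (Cons j js)
  have "\<bar>x $ j\<bar> \<le> R"
    using component_le_norm_cart[of x j] assms by linarith
  then show ?case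
    using Cons by (simp add: abs_mult mult_mono)
qed simp

lemma abs_entry_le_tensor_norm: "length js = m \<Longrightarrow> \<bar>A js\<bar> \<le> tensor_norm m A"
  unfolding tensor_norm_def
  using member_le_sum[of js "{js. length js = m}" "\<lambda>js. (A js)\<^sup>2"]
  by (intro real_le_rsqrt) auto

text \<open>The constant depends on R but not on the tensors, so it is uniform over all
  perturbations; with one tensor zero it also bounds the tensor map itself.\<close>

lemma tensor_vec_diff_bound:
  assumes "m > 0" "R \<ge> 0"
  obtains C where "C \<ge> 0" "\<And>A B (x :: real ^ 'n::finite). norm x \<le> R \<Longrightarrow>
    norm (tensor_vec m B x - tensor_vec m A x) \<le> C * tensor_norm m (B - A)"
proof -
  define N where "N = card {js :: 'n list. length js = m - 1}"
  have "norm (tensor_vec m B x - tensor_vec m A x) \<le> (real CARD('n) * N * R ^ (m - 1)) * tensor_norm m (B - A)"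
    if x: "norm x \<le> R" for A B and x :: "real ^ 'n"
  proof -
    have comp: "\<bar>(tensor_vec m B x - tensor_vec m A x) $ i\<bar> \<le> real N * (tensor_norm m (B - A) * R ^ (m - 1))" for i
    proof -
      have "(tensor_vec m B x - tensor_vec m A x) $ i =
          (\<Sum>js | length js = m - 1. (B - A) (i # js) * (\<Prod>j\<leftarrow>js. x $ j))"
        by (simp add: tensor_vec_def left_diff_distrib sum_subtractf)
      also have "\<bar>\<dots>\<bar> \<le> (\<Sum>js :: 'n list | length js = m - 1. tensor_norm m (B - A) * R ^ (m - 1))"
      proof (rule order_trans[OF sum_abs], rule sum_mono)
        fix js :: "'n list" assume js: "js \<in> {js. length js = m - 1}"
        \<comment> \<open>Positivity of m ensures that \<open>i # js\<close> has length m although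
          \<open>m - 1\<close> is truncated subtraction.\<close>
        then have "\<bar>(B - A) (i # js)\<bar> \<le> tensor_norm m (B - A)"
          using assms(1) by (intro abs_entry_le_tensor_norm) simp
        moreover have "\<bar>\<Prod>j\<leftarrow>js. x $ j\<bar> \<le> R ^ (m - 1)"
          using abs_monomial_le[OF x, of js] js by simp
        ultimately show "\<bar>(B - A) (i # js) * (\<Prod>j\<leftarrow>js. x $ j)\<bar> \<le> tensor_norm m (B - A) * R ^ (m - 1)"
          unfolding abs_mult by (intro mult_mono) auto
      qed
      also have "\<dots> = real N * (tensor_norm m (B - A) * R ^ (m - 1))"
        by (simp add: N_def)
      finally show ?thesis .
    qed
    have "norm (tensor_vec m B x - tensor_vec m A x) \<le> (\<Sum>i\<in>UNIV. \<bar>(tensor_vec m B x - tensor_vec m A x) $ i\<bar>)"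
      by (rule norm_le_l1_cart)
    also have "\<dots> \<le> (\<Sum>i\<in>(UNIV :: 'n set). real N * (tensor_norm m (B - A) * R ^ (m - 1)))"
      using comp by (intro sum_mono) auto
    finally show ?thesis by (simp add: mult_ac)
  qed
  then show ?thesis
    using that[of "real CARD('n) * N * R ^ (m - 1)"] assms(2) by simp
qed

lemma tensor_vec_scaleR:
  "tensor_vec m B (c *\<^sub>R x) = c ^ (m - 1) *\<^sub>R tensor_vec m B x"
proof -
  have "(\<Prod>j\<leftarrow>js. (c *\<^sub>R x) $ j) = c ^ length js * (\<Prod>j\<leftarrow>js. x $ j)" for js
    by (induction js) auto
  then show ?thesis
    by (simp add: vec_eq_iff tensor_vec_def sum_distrib_left mult_ac)
qed

lemma real_polynomial_function_tensor_vec: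
  assumes "\<And>j. real_polynomial_function (\<lambda>p. u p $ j)"
  shows "real_polynomial_function (\<lambda>p. tensor_vec m B (u p) $ i)"
proof -
  have "real_polynomial_function (\<lambda>p. \<Prod>j\<leftarrow>js. u p $ j)" for js
    by (induction js) (auto intro: real_polynomial_function.intros assms)
  then show ?thesis
    unfolding tensor_vec_def vec_lambda_beta
    by (intro real_polynomial_function_sum real_polynomial_function.intros(4)[OF real_polynomial_function.intros(2)]) auto
qed

lemma continuous_on_tensor_vec: "continuous_on S (tensor_vec m B)"
proof -
  have "continuous_on S (\<lambda>x. tensor_vec m B x $ i)" for i
    using real_polynomial_function_tensor_vec[of "\<lambda>x. x" m B i] bounded_linear_vec_nth
    by (intro continuous_on_polymonial_function) (auto simp: real_polynomial_function_eq[symmetric])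
  then have "continuous_on S (\<lambda>x. \<chi> i. tensor_vec m B x $ i)"
    by (intro continuous_on_vec_lambda)
  then show ?thesis by simp
qed

text \<open>A small step from a in direction -v stays in the dual cone; pairing the result with v
  shows that \<open>v \<bullet> a\<close> is at least \<open>e * norm v\<close>.\<close>

lemma interior_dual_cone_pos:
  assumes "a \<in> interior (dual_cone C)" "v \<in> C" "v \<noteq> 0"
  shows "0 < v \<bullet> a"
proof -
  obtain e where e: "e > 0" "cball a e \<subseteq> dual_cone C"
    using assms(1) by (auto simp: mem_interior_cball)
  have "a - (e / norm v) *\<^sub>R v \<in> cball a e"
    using e(1) assms(3) by (simp add: dist_norm)
  then have "a - (e / norm v) *\<^sub>R v \<in> dual_cone C"
    using e(2) by blast
  then have "0 \<le> v \<bullet> (a - (e / norm v) *\<^sub>R v)"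
    using assms(2) by (simp add: dual_cone_def)
  also have "\<dots> = v \<bullet> a - e * norm v"
    using assms(3) by (simp add: inner_diff_right dot_square_norm power2_eq_square)
  finally have "e * norm v \<le> v \<bullet> a" by simp
  moreover have "0 < e * norm v" using e(1) assms(3) by simp
  ultimately show ?thesis by linarith
qed

section \<open>Variational inequalities on truncated orthants\<close>

definition orthant_ball :: "real \<Rightarrow> (real ^ 'n) set" where
  "orthant_ball r = {x. (\<forall>i. 0 \<le> x $ i) \<and> norm x \<le> r}"

text \<open>The complementarity problem is the variational inequality over the whole orthant.
  Intersecting with a ball makes the domain compact, at the price of possible spurious solutions on
  the bounding sphere.\<close>

definition truncated_VI :: "nat \<Rightarrow> 'n::finite tensor \<Rightarrow> real ^ 'n \<Rightarrow> real \<Rightarrow> real ^ 'n \<Rightarrow> bool" where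
  "truncated_VI m B b r x \<longleftrightarrow>
     x \<in> orthant_ball r \<and> (\<forall>y\<in>orthant_ball r. 0 \<le> (tensor_vec m B x + b) \<bullet> (y - x))"

lemma compact_orthant_ball: "compact (orthant_ball r :: (real ^ 'n) set)"
proof -
  have "orthant_ball r = {x :: real ^ 'n. \<forall>i. 0 \<le> x $ i} \<inter> cball 0 r"
    by (auto simp: orthant_ball_def)
  moreover have "closed {x :: real ^ 'n. \<forall>i. 0 \<le> x $ i}"
    by (intro closed_Collect_all closed_Collect_le continuous_intros)
  ultimately show ?thesis by (simp add: closed_Int_compact)
qed

lemma convex_orthant_ball: "convex (orthant_ball r :: (real ^ 'n) set)"
proof -
  have "orthant_ball r = {x :: real ^ 'n. \<forall>i. 0 \<le> x $ i} \<inter> cball 0 r"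
    by (auto simp: orthant_ball_def)
  moreover have "convex {x :: real ^ 'n. \<forall>i. 0 \<le> x $ i}"
    by (auto simp: convex_def)
  ultimately show ?thesis by (simp add: convex_Int)
qed

text \<open>A fixed point of the projected step \<open>x \<mapsto> proj (x - F x)\<close> solves the variational inequality.\<close>

lemma truncated_VI_solvable:
  assumes "r \<ge> 0"
  obtains x where "truncated_VI m B b r x"
proof -
  let ?K = "orthant_ball r :: (real ^ 'n) set"
  let ?f = "\<lambda>x. closest_point ?K (x - (tensor_vec m B x + b))"
  have K: "compact ?K" "convex ?K" "closed ?K" "?K \<noteq> {}"
    using compact_orthant_ball convex_orthant_ball compact_imp_closed assms
    by (auto simp: orthant_ball_def intro: exI[of _ 0])
  have "continuous_on ?K (\<lambda>x. x - (tensor_vec m B x + b))"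
    by (intro continuous_intros continuous_on_tensor_vec)
  then have "continuous_on ?K ?f"
    using continuous_on_compose2[OF continuous_on_closest_point[OF K(2,3,4), of UNIV]] by simp
  then obtain x where x: "x \<in> ?K" "?f x = x"
    using brouwer[OF K(1,2,4)] closest_point_in_set[OF K(3,4)] by blast
  have "0 \<le> (tensor_vec m B x + b) \<bullet> (y - x)" if "y \<in> ?K" for y
  proof -
    have "(x - (tensor_vec m B x + b) - x) \<bullet> (y - x) \<le> 0"
      using closest_point_dot[OF K(2,3) that, of "x - (tensor_vec m B x + b)"] unfolding x(2) .
    moreover have "x - (tensor_vec m B x + b) - x = - (tensor_vec m B x + b)" by simp
    ultimately show ?thesis by (simp only: inner_minus_left)
  qed
  then show ?thesis using x(1) that by (auto simp: truncated_VI_def)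
qed

lemma inner_nonneg_vec:
  fixes x y :: "real ^ 'n"
  shows "(\<And>i. 0 \<le> x $ i) \<Longrightarrow> (\<And>i. 0 \<le> y $ i) \<Longrightarrow> 0 \<le> x \<bullet> y"
  by (simp add: inner_vec_def sum_nonneg)

lemma Sol_inner_eq_0: "x \<in> Sol m B b \<Longrightarrow> x \<bullet> (tensor_vec m B x + b) = 0"
  by (simp add: Sol_def tensor_form_def inner_add_right)

text \<open>The truncation radius is the norm of x itself, so x lies on the bounding sphere; a bound
  for truncated solutions there is therefore a bound for all of \<open>Sol\<close>.\<close>

lemma Sol_imp_truncated_VI:
  assumes "x \<in> Sol m B b"
  shows "truncated_VI m B b (norm x) x"
proof -
  have "0 \<le> (tensor_vec m B x + b) \<bullet> (y - x)" if "\<forall>i. 0 \<le> y $ i" for y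
  proof -
    have "0 \<le> (tensor_vec m B x + b) \<bullet> y"
      using assms that by (intro inner_nonneg_vec) (auto simp: Sol_def)
    then show ?thesis
      using Sol_inner_eq_0[OF assms] unfolding inner_diff_right inner_commute[of _ x] by simp
  qed
  then show ?thesis
    using assms by (auto simp: truncated_VI_def orthant_ball_def Sol_def)
qed

text \<open>Strictly inside the sphere there is room to move outwards: adding a multiple of a unit
  vector gives the sign of each component, and the test points 0 and
  \<open>(r / norm x) *\<^sub>R x\<close> force the complementarity product to be 0.\<close>

lemma truncated_VI_imp_Sol:
  assumes VI: "truncated_VI m B b r x" and "norm x < r"
  shows "x \<in> Sol m B b"
proof -
  let ?G = "tensor_vec m B x + b"
  have x: "\<And>i. 0 \<le> x $ i" using VI by (auto simp: truncated_VI_def orthant_ball_def)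
  have G: "0 \<le> ?G \<bullet> (y - x)" if "\<And>i. 0 \<le> y $ i" "norm y \<le> r" for y
    using VI that by (auto simp: truncated_VI_def orthant_ball_def)
  have "0 \<le> ?G $ i" for i
  proof -
    have "norm (x + (r - norm x) *\<^sub>R axis i 1) \<le> norm x + (r - norm x)"
      using assms(2) norm_triangle_ineq[of x "(r - norm x) *\<^sub>R axis i 1"] by simp
    then have "0 \<le> ?G \<bullet> (x + (r - norm x) *\<^sub>R axis i 1 - x)"
      using assms(2) x by (intro G) (auto simp: axis_def)
    then have "0 \<le> (r - norm x) * (?G $ i)"
      by (simp add: inner_axis)
    then show ?thesis
      using assms(2) by (simp add: zero_le_mult_iff)
  qed
  moreover have "?G \<bullet> x = 0"
  proof (cases "x = 0")
    case False
    have "0 \<le> r" using assms(2) norm_ge_zero[of x] by linarith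
    have "0 \<le> ?G \<bullet> ((r / norm x) *\<^sub>R x - x)"
      using False x \<open>0 \<le> r\<close> by (intro G) auto
    also have "\<dots> = (r / norm x - 1) * (?G \<bullet> x)"
      by (simp add: inner_diff_right algebra_simps)
    finally have "0 \<le> (r / norm x - 1) * (?G \<bullet> x)" .
    moreover have "0 < r / norm x - 1"
      using False assms(2) by simp
    ultimately have "0 \<le> ?G \<bullet> x"
      using zero_le_mult_iff[of "r / norm x - 1" "?G \<bullet> x"] by linarith
    moreover have "0 \<le> ?G \<bullet> (0 - x)"
      using \<open>0 \<le> r\<close> by (intro G) auto
    ultimately show ?thesis by simp
  qed simp
  ultimately show ?thesis
    using x by (auto simp: Sol_def tensor_form_def inner_add_right inner_add_left inner_commute)
qed

text \<open>
  Solutions on the sphere of radius \<open>r\<close> with \<open>r \<rightarrow> \<infinity>\<close>, once normalised, accumulate at a nonzero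
  \<open>l \<in> Sol m A 0\<close> with \<open>l \<bullet> a \<le> 0\<close>.
\<close>

lemma truncated_VI_sphere_bound:
  fixes A :: "'n::finite tensor"
  assumes "m \<ge> 2" and a: "a \<in> interior (dual_cone (Sol m A 0))"
  obtains \<epsilon> R where "\<epsilon> > 0" "R > 0" "\<And>B b x. copositive m B \<Longrightarrow> tensor_norm m (B - A) < \<epsilon> \<Longrightarrow>
    norm (b - a) < \<epsilon> \<Longrightarrow> truncated_VI m B b (norm x) x \<Longrightarrow> norm x \<le> R"
proof (rule ccontr)
  assume neg: "\<not> thesis"
  have "\<exists>B b x. copositive m B \<and> tensor_norm m (B - A) < 1 / Suc k \<and> norm (b - a) < 1 / Suc k \<and>
      truncated_VI m B b (norm x) x \<and> norm x > Suc k" for k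
  proof (rule ccontr)
    assume "\<not> ?thesis"
    then show False
      using neg that[of "1 / Suc k" "Suc k"] by (force simp: not_less)
  qed
  then obtain B b x where B: "\<And>k. copositive m (B k)" "\<And>k. tensor_norm m (B k - A) < 1 / Suc k"
    and b: "\<And>k. norm (b k - a) < 1 / Suc k" and VI: "\<And>k. truncated_VI m (B k) (b k) (norm (x k)) (x k)"
    and x: "\<And>k. norm (x k) > Suc k"
    by metis
  have x_pos: "norm (x k) > 0" for k
    using x[of k] by linarith
  define u where "u k = x k /\<^sub>R norm (x k)" for k
  have x_eq: "x k = norm (x k) *\<^sub>R u k" for k
    using x_pos[of k] by (simp add: u_def)
  have norm_u: "norm (u k) = 1" for k
    using x_pos[of k] by (simp add: u_def)
  have u_nonneg: "0 \<le> u k $ i" for k i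
    using VI[of k] by (auto simp: truncated_VI_def orthant_ball_def u_def)
  have "seq_compact (sphere (0 :: real ^ 'n) 1)"
    by (intro compact_imp_seq_compact compact_sphere)
  then obtain l s where l: "norm l = 1" "strict_mono s" "(u \<circ> s) \<longlonglongrightarrow> l"
    using norm_u by (auto elim!: seq_compactE[of _ u])
  have u_lim: "(\<lambda>k. u (s k)) \<longlonglongrightarrow> l" using l(3) by (simp add: o_def)
  have inv_lim: "(\<lambda>k. 1 / Suc (s k)) \<longlonglongrightarrow> 0"
    using LIMSEQ_subseq_LIMSEQ[OF LIMSEQ_Suc[OF lim_1_over_n] l(2)] by (simp add: o_def)
  have b_lim: "(\<lambda>k. b (s k)) \<longlonglongrightarrow> a"
  proof (rule LIM_zero_cancel, rule Lim_null_comparison[OF _ inv_lim])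
    show "\<forall>\<^sub>F k in sequentially. norm (b (s k) - a) \<le> 1 / Suc (s k)"
      by (intro always_eventually allI less_imp_le b)
  qed
  have F_lim: "(\<lambda>k. tensor_vec m (B (s k)) (u (s k))) \<longlonglongrightarrow> tensor_vec m A l"
  proof -
    obtain C where C: "C \<ge> 0" "\<And>A B (x :: real ^ 'n). norm x \<le> 1 \<Longrightarrow>
        norm (tensor_vec m B x - tensor_vec m A x) \<le> C * tensor_norm m (B - A)"
      using tensor_vec_diff_bound[of m 1] assms(1) by auto
    have "(\<lambda>k. tensor_vec m (B (s k)) (u (s k)) - tensor_vec m A (u (s k))) \<longlonglongrightarrow> 0"
    proof (rule Lim_null_comparison)
      show "\<forall>\<^sub>F k in sequentially. norm (tensor_vec m (B (s k)) (u (s k)) - tensor_vec m A (u (s k)))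
          \<le> C * (1 / Suc (s k))"
        using C(1) B(2) norm_u by (intro always_eventually allI order_trans[OF C(2)] mult_left_mono) (auto intro: less_imp_le)
      show "(\<lambda>k. C * (1 / Suc (s k))) \<longlonglongrightarrow> 0"
        using tendsto_mult_left[OF inv_lim, of C] by simp
    qed
    moreover have "(\<lambda>k. tensor_vec m A (u (s k))) \<longlonglongrightarrow> tensor_vec m A l"
      using continuous_on_tensor_vec[of UNIV m A] u_lim by (rule continuous_on_tendsto_compose) auto
    ultimately show ?thesis
      using tendsto_add by fastforce
  qed
  \<comment> \<open>The tensor map scales with \<open>norm x ^ (m - 1)\<close>, so after
    normalisation b is divided by this power; it becomes negligible because \<open>m \<ge> 2\<close>
    makes the exponent positive.\<close>
  have pert_lim: "(\<lambda>k. b (s k) /\<^sub>R norm (x (s k)) ^ (m - 1)) \<longlonglongrightarrow> 0"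
  proof (rule Lim_null_comparison)
    show "(\<lambda>k. norm (b (s k)) * (1 / Suc (s k))) \<longlonglongrightarrow> 0"
      using tendsto_mult[OF tendsto_norm[OF b_lim] inv_lim] by simp
    have "norm (b (s k) /\<^sub>R norm (x (s k)) ^ (m - 1)) \<le> norm (b (s k)) * (1 / Suc (s k))" for k
    proof -
      have "norm (x (s k)) ^ 1 \<le> norm (x (s k)) ^ (m - 1)"
        using x[of "s k"] assms(1) by (intro power_increasing) linarith+
      then have "real (Suc (s k)) \<le> norm (x (s k)) ^ (m - 1)"
        using x[of "s k"] by simp
      then have "inverse (norm (x (s k)) ^ (m - 1)) \<le> 1 / Suc (s k)"
        unfolding inverse_eq_divide by (intro divide_left_mono) auto
      then have "norm (b (s k)) * inverse (norm (x (s k)) ^ (m - 1)) \<le> norm (b (s k)) * (1 / Suc (s k))"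
        by (rule mult_left_mono) simp
      then show ?thesis
        by (simp add: mult.commute power_abs)
    qed
    then show "\<forall>\<^sub>F k in sequentially. norm (b (s k) /\<^sub>R norm (x (s k)) ^ (m - 1)) \<le> norm (b (s k)) * (1 / Suc (s k))"
      by simp
  qed
  have l_nonneg: "0 \<le> l $ i" for i
    using tendsto_vec_nth[OF u_lim, of i] u_nonneg by (intro LIMSEQ_le_const) auto
  \<comment> \<open>Rescaling the ball of radius \<open>norm (x k)\<close> to radius 1 gives all
    these inequalities the same test set, so the limit can be taken for each fixed y.\<close>
  have VI_l: "0 \<le> tensor_vec m A l \<bullet> (y - l)" if y: "y \<in> orthant_ball 1" for y
  proof (rule LIMSEQ_le_const)
    show "(\<lambda>k. (tensor_vec m (B (s k)) (u (s k)) + b (s k) /\<^sub>R norm (x (s k)) ^ (m - 1)) \<bullet> (y - u (s k)))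
      \<longlonglongrightarrow> tensor_vec m A l \<bullet> (y - l)"
      using tendsto_inner[OF tendsto_add[OF F_lim pert_lim] tendsto_diff[OF tendsto_const u_lim]] by simp
    have "0 \<le> (tensor_vec m (B k) (u k) + b k /\<^sub>R norm (x k) ^ (m - 1)) \<bullet> (y - u k)" for k
    proof -
      let ?n = "norm (x k)"
      have "?n *\<^sub>R y \<in> orthant_ball ?n"
        using y by (auto simp: orthant_ball_def mult_left_le)
      then have "0 \<le> (tensor_vec m (B k) (?n *\<^sub>R u k) + b k) \<bullet> (?n *\<^sub>R y - ?n *\<^sub>R u k)"
        using VI[of k] x_eq[of k] unfolding truncated_VI_def by metis
      also have "tensor_vec m (B k) (?n *\<^sub>R u k) + b k =
          ?n ^ (m - 1) *\<^sub>R (tensor_vec m (B k) (u k) + b k /\<^sub>R ?n ^ (m - 1))"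
        using x_pos[of k] by (simp add: tensor_vec_scaleR scaleR_add_right)
      also have "\<dots> \<bullet> (?n *\<^sub>R y - ?n *\<^sub>R u k) =
          (?n ^ (m - 1) * ?n) * ((tensor_vec m (B k) (u k) + b k /\<^sub>R ?n ^ (m - 1)) \<bullet> (y - u k))"
        by (simp flip: scaleR_diff_right)
      finally show ?thesis
        using x_pos[of k] zero_le_mult_iff[of "?n ^ (m - 1) * ?n"] zero_less_power[of ?n "m - 1"]
        by (metis mult_pos_pos not_less)
    qed
    then show "\<exists>N. \<forall>n\<ge>N. 0 \<le> (tensor_vec m (B (s n)) (u (s n)) + b (s n) /\<^sub>R norm (x (s n)) ^ (m - 1)) \<bullet> (y - u (s n))"
      by blast
  qed
  have "0 \<le> l \<bullet> tensor_vec m A l"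
  proof (rule LIMSEQ_le_const)
    show "(\<lambda>k. u (s k) \<bullet> tensor_vec m (B (s k)) (u (s k))) \<longlonglongrightarrow> l \<bullet> tensor_vec m A l"
      by (intro tendsto_inner u_lim F_lim)
    show "\<exists>N. \<forall>n\<ge>N. 0 \<le> u (s n) \<bullet> tensor_vec m (B (s n)) (u (s n))"
      using B(1) u_nonneg by (auto simp: copositive_def tensor_form_def)
  qed
  moreover have "(0 :: real ^ 'n) \<in> orthant_ball 1"
    by (simp add: orthant_ball_def)
  ultimately have l0: "tensor_vec m A l \<bullet> l = 0"
    using VI_l[of 0] by (simp add: inner_commute)
  have "0 \<le> tensor_vec m A l $ i" for i
  proof -
    have "axis i 1 \<in> orthant_ball 1"
      using norm_axis_1[of i] by (simp add: orthant_ball_def) (simp add: axis_def)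
    from VI_l[OF this] show ?thesis
      using l0 by (simp add: inner_diff_right inner_axis)
  qed
  then have "l \<in> Sol m A 0"
    using l_nonneg l0 by (simp add: Sol_def tensor_form_def inner_commute)
  moreover have "l \<noteq> 0" using l(1) by auto
  ultimately have "0 < l \<bullet> a"
    using a by (intro interior_dual_cone_pos)
  \<comment> \<open>The test point 0 shows that the product of x with
    \<open>tensor_vec m B x + b\<close> is at most 0, and copositivity allows the tensor part to be
    dropped. The sign of \<open>x \<bullet> b\<close> is kept by normalisation and passes to the
    limit.\<close>
  moreover have "l \<bullet> a \<le> 0"
  proof (rule LIMSEQ_le_const2)
    show "(\<lambda>k. u (s k) \<bullet> b (s k)) \<longlonglongrightarrow> l \<bullet> a"
      by (intro tendsto_inner u_lim b_lim)
    have "u k \<bullet> b k \<le> 0" for k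
    proof -
      have "0 \<le> (tensor_vec m (B k) (x k) + b k) \<bullet> (0 - x k)"
      proof -
        have "0 \<in> orthant_ball (norm (x k))" by (simp add: orthant_ball_def)
        then show ?thesis using VI[of k] unfolding truncated_VI_def by blast
      qed
      moreover have "0 \<le> x k \<bullet> tensor_vec m (B k) (x k)"
        using B(1)[of k] VI[of k] by (auto simp: copositive_def tensor_form_def truncated_VI_def orthant_ball_def)
      ultimately have "x k \<bullet> b k \<le> 0"
        by (simp add: inner_commute[of _ "x k"] inner_add_right)
      then show ?thesis
        by (simp add: u_def mult_le_0_iff)
    qed
    then show "\<exists>N. \<forall>n\<ge>N. u (s n) \<bullet> b (s n) \<le> 0" by blast
  qed
  ultimately show False by linarith
qed

section \<open>Polynomial residual and the Hoelder estimate for solutions\<close>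

text \<open>
  Writing \<open>x = y\<^sup>2\<close> and \<open>A x\<^bsup>m-1\<^esup> + a = z\<^sup>2\<close> componentwise turns the complementarity problem into
  the vanishing of one polynomial in \<open>(y, z)\<close>.
\<close>

definition residual :: "nat \<Rightarrow> 'n::finite tensor \<Rightarrow> real ^ 'n \<Rightarrow> (real ^ 'n) \<times> (real ^ 'n) \<Rightarrow> real" where
  "residual m A a = (\<lambda>(y, z).
     (\<Sum>i\<in>UNIV. (tensor_vec m A (\<chi> j. (y $ j)\<^sup>2) $ i + a $ i - (z $ i)\<^sup>2)\<^sup>2) + (\<Sum>i\<in>UNIV. (y $ i * z $ i)\<^sup>2))"

lemma real_polynomial_function_residual:
  fixes A :: "'n::finite tensor"
  shows "real_polynomial_function (residual m A a)"
proof -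
  have y: "real_polynomial_function (\<lambda>p :: (real ^ 'n) \<times> (real ^ 'n). fst p $ i)" for i
    by (intro real_polynomial_function.intros(1) bounded_linear_compose[OF bounded_linear_vec_nth] bounded_linear_fst)
  have z: "real_polynomial_function (\<lambda>p :: (real ^ 'n) \<times> (real ^ 'n). snd p $ i)" for i
    by (intro real_polynomial_function.intros(1) bounded_linear_compose[OF bounded_linear_vec_nth] bounded_linear_snd)
  have "real_polynomial_function (\<lambda>p :: (real ^ 'n) \<times> (real ^ 'n). tensor_vec m A (\<chi> j. (fst p $ j)\<^sup>2) $ i)" for i
    by (intro real_polynomial_function_tensor_vec) (simp add: real_polynomial_function_power[OF y])
  then show ?thesis
    unfolding residual_def case_prod_unfold
    by (intro real_polynomial_function.intros(3) real_polynomial_function_sum real_polynomial_function_power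
        real_polynomial_function_diff real_polynomial_function.intros(2) real_polynomial_function.intros(4) y z) auto
qed

lemma residual_eq_0_imp_Sol:
  assumes "residual m A a (y, z) = 0"
  shows "(\<chi> j. (y $ j)\<^sup>2) \<in> Sol m A a"
proof -
  let ?x = "\<chi> j. (y $ j)\<^sup>2"
  have "(\<Sum>i\<in>UNIV. (tensor_vec m A ?x $ i + a $ i - (z $ i)\<^sup>2)\<^sup>2) = 0 \<and> (\<Sum>i\<in>UNIV. (y $ i * z $ i)\<^sup>2) = 0"
    using assms unfolding residual_def prod.case
    by (subst (asm) add_nonneg_eq_0_iff) (auto intro: sum_nonneg)
  then have F: "(tensor_vec m A ?x + a) $ i = (z $ i)\<^sup>2" and yz: "y $ i * z $ i = 0" for i
    by (simp_all add: sum_nonneg_eq_0_iff)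
  have "?x \<bullet> (tensor_vec m A ?x + a) = (\<Sum>i\<in>UNIV. (y $ i * z $ i)\<^sup>2)"
    unfolding inner_vec_def F by (simp add: power_mult_distrib)
  also have "\<dots> = 0" by (simp add: yz)
  finally show ?thesis
    using F by (simp add: Sol_def tensor_form_def inner_add_right)
qed

text \<open>With square roots as slack variables the products vanish, because complementarity
  between nonnegative vectors holds in each component. What remains is the difference of the two
  maps at the same point x.\<close>

lemma residual_sqrt:
  assumes "x \<in> Sol m B b"
  shows "residual m A a (\<chi> i. sqrt (x $ i), \<chi> i. sqrt ((tensor_vec m B x + b) $ i)) =
    (norm (tensor_vec m A x + a - (tensor_vec m B x + b)))\<^sup>2"
proof -
  let ?G = "tensor_vec m B x + b"
  have nonneg: "0 \<le> x $ i" "0 \<le> ?G $ i" for i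
    using assms by (auto simp: Sol_def)
  have "(\<Sum>i\<in>UNIV. x $ i * ?G $ i) = 0"
    using Sol_inner_eq_0[OF assms] by (simp add: inner_vec_def)
  then have "x $ i * ?G $ i = 0" for i
    using nonneg by (subst (asm) sum_nonneg_eq_0_iff) auto
  then have "sqrt (x $ i) * sqrt (?G $ i) = 0" for i
    by (metis real_sqrt_mult real_sqrt_zero)
  then have "(\<Sum>i\<in>UNIV. (sqrt (x $ i) * sqrt (?G $ i))\<^sup>2) = 0"
    by (simp only: zero_power2 sum.neutral_const)
  moreover have "(\<chi> i. (sqrt (x $ i))\<^sup>2) = x" "(sqrt (?G $ i))\<^sup>2 = ?G $ i" for i
    using nonneg by (simp_all add: vec_eq_iff)
  ultimately show ?thesis
    unfolding residual_def power2_norm_eq_inner inner_vec_def prod.case vec_lambda_beta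
    by (simp add: power2_eq_square)
qed

text \<open>The polynomial inequality yields an exact zero (y, z) of the residual near the point of
  square roots. Distances then only have to be carried from y to its square, which is Lipschitz on
  bounded sets, and not through the square root, which is not.\<close>

lemma Sol_Hoelder_bound:
  fixes A :: "'n::finite tensor"
  assumes "m > 0" "R \<ge> 0"
  obtains \<theta> \<epsilon> where "modulus \<theta>" "\<epsilon> > 0" "\<And>B b x. tensor_norm m (B - A) + norm (b - a) \<le> \<epsilon> \<Longrightarrow>
    x \<in> Sol m B b \<Longrightarrow> norm x \<le> R \<Longrightarrow>
    \<exists>x'\<in>Sol m A a. norm (x - x') \<le> \<theta> (tensor_norm m (B - A) + norm (b - a))"
proof -
  obtain C where C: "C \<ge> 0" "\<And>A B (x :: real ^ 'n). norm x \<le> R \<Longrightarrow>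
      norm (tensor_vec m B x - tensor_vec m A x) \<le> C * tensor_norm m (B - A)"
    using tensor_vec_diff_bound[OF assms, where 'n = 'n] by blast
  \<comment> \<open>At the square roots the residual is a squared norm, at most ((C + 1) e)^2 for a
    perturbation of size e.\<close>
  define K where "K = (C + 1)\<^sup>2"
  have "K > 0" using C(1) by (simp add: K_def)
  \<comment> \<open>\<open>M\<close> bounds the slack vector \<open>tensor_vec m B x + b\<close> for
    perturbations of size at most 1; \<open>R'\<close> then bounds the pair of vectors of square
    roots.\<close>
  define M where "M = C * tensor_norm m A + norm a + C + 1"
  have "M \<ge> 0" using C(1) by (simp add: M_def tensor_norm_def sum_nonneg)
  define R' where "R' = real CARD('n) * sqrt R + real CARD('n) * sqrt M"
  have "R' \<ge> 0" using \<open>M \<ge> 0\<close> assms(2) by (simp add: R'_def)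
  have "lojasiewicz UNIV (residual m A a)"
    by (intro lojasiewicz_inequality real_polynomial_function_residual) auto
  then obtain \<phi> \<delta> where \<phi>: "modulus \<phi>" "\<delta> > 0"
    and loj: "\<forall>p\<in>UNIV \<inter> cball 0 R'. \<bar>residual m A a p\<bar> \<le> \<delta> \<longrightarrow>
      (\<exists>q\<in>UNIV. residual m A a q = 0 \<and> norm (p - q) \<le> \<phi> \<bar>residual m A a p\<bar>)"
    unfolding lojasiewicz_def by blast
  define \<psi> where "\<psi> e = \<phi> (K * e powr 2)" for e
  have sq: "modulus (\<lambda>e. K * e powr 2)"
    using \<open>K > 0\<close> by (intro modulusI) auto
  have \<psi>: "modulus \<psi>"
    unfolding \<psi>_def[abs_def] by (rule modulus_compose[OF \<phi>(1) sq])
  obtain \<epsilon>1 where \<epsilon>1: "\<epsilon>1 > 0" "\<And>e. 0 \<le> e \<Longrightarrow> e \<le> \<epsilon>1 \<Longrightarrow> K * e powr 2 \<le> \<delta>"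
    using modulus_small[OF sq \<phi>(2)] by blast
  obtain \<epsilon>2 where \<epsilon>2: "\<epsilon>2 > 0" "\<And>e. 0 \<le> e \<Longrightarrow> e \<le> \<epsilon>2 \<Longrightarrow> \<psi> e \<le> 1"
    using modulus_small[OF \<psi>, of 1] by auto
  \<comment> \<open>In x_i - y_i^2 = (sqrt x_i - y_i) (sqrt x_i + y_i) the second factor is at most
    \<open>2 * R' + 1\<close> once y is within distance 1 of the square roots; the factor
    \<open>real CARD('n)\<close> comes from the l1 norm.\<close>
  define D where "D = real CARD('n) * (2 * R' + 1)"
  have "D > 0" using \<open>R' \<ge> 0\<close> by (simp add: D_def)
  \<comment> \<open>The threshold 1 keeps the slack vector within \<open>M\<close>,
    \<open>\<epsilon>1\<close> brings the residual below \<open>\<delta>\<close>, and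
    \<open>\<epsilon>2\<close> keeps the zero within distance 1.\<close>
  have "\<exists>x'\<in>Sol m A a. norm (x - x') \<le> D * \<psi> (tensor_norm m (B - A) + norm (b - a))"
    if e: "tensor_norm m (B - A) + norm (b - a) \<le> Min {1, \<epsilon>1, \<epsilon>2}" and x: "x \<in> Sol m B b" "norm x \<le> R"
    for B b x
  proof -
    define e where "e = tensor_norm m (B - A) + norm (b - a)"
    have tn: "0 \<le> tensor_norm m (B - A)" by (simp add: tensor_norm_def sum_nonneg)
    then have e_bounds: "0 \<le> e" "e \<le> 1" "e \<le> \<epsilon>1" "e \<le> \<epsilon>2" "tensor_norm m (B - A) \<le> e" "norm (b - a) \<le> e"
      using e by (auto simp: e_def)
    let ?G = "tensor_vec m B x + b"
    have nonneg: "0 \<le> x $ i" "0 \<le> ?G $ i" for i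
      using x(1) by (auto simp: Sol_def)
    have diff: "norm (tensor_vec m A x + a - ?G) \<le> (C + 1) * e"
    proof -
      have "tensor_vec m A x + a - ?G = - ((tensor_vec m B x - tensor_vec m A x) + (b - a))"
        by simp
      then have "norm (tensor_vec m A x + a - ?G) \<le> norm (tensor_vec m B x - tensor_vec m A x) + norm (b - a)"
        using norm_triangle_ineq norm_minus_cancel by metis
      also have "\<dots> \<le> C * e + e"
        using C(2)[OF x(2), of B A] mult_left_mono[OF e_bounds(5) C(1)] e_bounds(6) by linarith
      finally show ?thesis by (simp add: algebra_simps)
    qed
    have G_bound: "norm ?G \<le> M"
    proof -
      have "norm (tensor_vec m A x) \<le> C * tensor_norm m A"
      proof -
        have "tensor_vec m (\<lambda>_. 0) x = 0" by (simp add: tensor_vec_def vec_eq_iff)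
        then show ?thesis using C(2)[OF x(2), of A "\<lambda>_. 0"] by (simp add: fun_diff_def)
      qed
      moreover have "(C + 1) * e \<le> C + 1"
        using C(1) e_bounds(2) by (simp add: mult_left_le)
      moreover have "norm ?G \<le> norm (tensor_vec m A x + a) + norm (tensor_vec m A x + a - ?G)"
        by (metis norm_minus_commute norm_triangle_sub)
      ultimately show ?thesis
        using diff norm_triangle_ineq[of "tensor_vec m A x" a] by (simp add: M_def)
    qed
    have norm_sqrt: "norm (\<chi> i. sqrt (v $ i)) \<le> real CARD('n) * sqrt S" if "norm v \<le> S" "\<And>i. 0 \<le> v $ i"
      for v :: "real ^ 'n" and S
    proof -
      have "norm (\<chi> i. sqrt (v $ i)) \<le> (\<Sum>i\<in>UNIV. \<bar>(\<chi> i. sqrt (v $ i)) $ i\<bar>)"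
        by (rule norm_le_l1_cart)
      also have "\<dots> \<le> (\<Sum>i\<in>(UNIV :: 'n set). sqrt S)"
        using that component_le_norm_cart[of v] by (intro sum_mono) (auto intro: order_trans)
      finally show ?thesis by simp
    qed
    define p where "p = (\<chi> i. sqrt (x $ i), \<chi> i. sqrt (?G $ i))"
    have norm_p: "norm p \<le> R'"
      unfolding p_def R'_def using norm_Pair_le norm_sqrt[OF x(2) nonneg(1)] norm_sqrt[OF G_bound nonneg(2)]
      by (meson add_mono order_trans)
    have "residual m A a p \<le> ((C + 1) * e)\<^sup>2"
      unfolding p_def residual_sqrt[OF x(1)] using diff by (intro power_mono) auto
    also have "\<dots> = K * e powr 2"
      using e_bounds(1) by (cases "e = 0") (simp_all add: K_def power_mult_distrib)
    finally have res: "\<bar>residual m A a p\<bar> \<le> K * e powr 2"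
      unfolding p_def residual_sqrt[OF x(1)] by simp
    then have "\<bar>residual m A a p\<bar> \<le> \<delta>"
      using \<epsilon>1(2) e_bounds by force
    then obtain y z where q: "residual m A a (y, z) = 0" "norm (p - (y, z)) \<le> \<phi> \<bar>residual m A a p\<bar>"
      using loj norm_p by (metis IntI UNIV_I mem_cball_0 surj_pair)
    have "\<phi> \<bar>residual m A a p\<bar> \<le> \<psi> e"
      unfolding \<psi>_def using res by (intro modulus_mono[OF \<phi>(1)]) auto
    with q(2) have pq: "norm (p - (y, z)) \<le> \<psi> e" by linarith
    have y_near: "norm (fst p - y) \<le> \<psi> e"
      using pq norm_fst_le[of "fst p - y" "snd p - z"] by (simp add: minus_prod_def)
    have comp: "\<bar>(x - (\<chi> j. (y $ j)\<^sup>2)) $ i\<bar> \<le> \<psi> e * (2 * R' + 1)" for i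
    proof -
      have p_i: "(fst p $ i)\<^sup>2 = x $ i"
        using nonneg by (simp add: p_def)
      have "\<bar>fst p $ i\<bar> \<le> R'"
        using component_le_norm_cart[of "fst p" i] norm_fst_le[of "fst p" "snd p"] norm_p by simp
      moreover have py: "\<bar>fst p $ i - y $ i\<bar> \<le> \<psi> e"
        using component_le_norm_cart[of "fst p - y" i] y_near by simp
      moreover have "\<psi> e \<le> 1" using \<epsilon>2(2) e_bounds by simp
      ultimately have "\<bar>fst p $ i + y $ i\<bar> \<le> 2 * R' + 1" by linarith
      then have "\<bar>fst p $ i - y $ i\<bar> * \<bar>fst p $ i + y $ i\<bar> \<le> \<psi> e * (2 * R' + 1)"
        using py modulus_nonneg[OF \<psi>] by (intro mult_mono) auto
      moreover have "(x - (\<chi> j. (y $ j)\<^sup>2)) $ i = (fst p $ i - y $ i) * (fst p $ i + y $ i)"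
        by (simp add: p_i[symmetric] power2_eq_square algebra_simps)
      ultimately show ?thesis by (simp add: abs_mult)
    qed
    have "norm (x - (\<chi> j. (y $ j)\<^sup>2)) \<le> (\<Sum>i\<in>UNIV. \<bar>(x - (\<chi> j. (y $ j)\<^sup>2)) $ i\<bar>)"
      by (rule norm_le_l1_cart)
    also have "\<dots> \<le> (\<Sum>i\<in>(UNIV :: 'n set). \<psi> e * (2 * R' + 1))"
      using comp by (intro sum_mono) auto
    finally have "norm (x - (\<chi> j. (y $ j)\<^sup>2)) \<le> D * \<psi> e"
      by (simp add: D_def mult_ac)
    then show ?thesis
      using residual_eq_0_imp_Sol[OF q(1)] by (auto simp: e_def)
  qed
  moreover have "modulus (\<lambda>e. D * \<psi> e)"
    by (rule modulus_scale[OF \<psi> \<open>D > 0\<close>])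
  ultimately show ?thesis
    using that[of "\<lambda>e. D * \<psi> e" "Min {1, \<epsilon>1, \<epsilon>2}"] \<epsilon>1(1) \<epsilon>2(1) by simp
qed

theorem theorem6p1:
  fixes m :: nat and A :: "'n::finite tensor" and a :: "real ^ 'n"
  assumes "m \<ge> 2" and "CARD('n) \<ge> 2"
    and "A \<in> tensors m"
    and "a \<in> interior (dual_cone (Sol m A 0))"
  shows "\<exists>\<epsilon>>0. \<exists>\<gamma>>0. \<exists>c>0. \<forall>B\<in>tensors m. \<forall>b :: real ^ 'n.
    max (tensor_norm m (B - A)) (norm (b - a)) < \<epsilon> \<and> copositive m B \<longrightarrow>
      (Sol m B b \<noteq> {} \<and> bounded (Sol m B b)) \<and>
      Sol m B b \<subseteq> Sol m A a +
        (\<lambda>u. (\<gamma> * (tensor_norm m (B - A) + norm (b - a)) powr c) *\<^sub>R u) ` cball 0 1"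
proof -
  obtain \<epsilon>1 R where R: "\<epsilon>1 > 0" "R > 0" "\<And>B b x. copositive m B \<Longrightarrow> tensor_norm m (B - A) < \<epsilon>1 \<Longrightarrow>
      norm (b - a) < \<epsilon>1 \<Longrightarrow> truncated_VI m B b (norm x) x \<Longrightarrow> norm x \<le> R"
    using truncated_VI_sphere_bound[OF assms(1,4)] by metis
  have "m > 0" "R \<ge> 0" using assms(1) R(2) by auto
  obtain \<theta> \<epsilon>2 where \<theta>: "modulus \<theta>" "\<epsilon>2 > 0" "\<And>B b x. tensor_norm m (B - A) + norm (b - a) \<le> \<epsilon>2 \<Longrightarrow>
      x \<in> Sol m B b \<Longrightarrow> norm x \<le> R \<Longrightarrow>
      \<exists>x'\<in>Sol m A a. norm (x - x') \<le> \<theta> (tensor_norm m (B - A) + norm (b - a))"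
    using Sol_Hoelder_bound[OF \<open>m > 0\<close> \<open>R \<ge> 0\<close>, of A a] by blast
  obtain \<gamma> c where \<gamma>: "\<gamma> > 0" "c > 0" "\<theta> = (\<lambda>t. \<gamma> * t powr c)"
    using \<theta>(1) unfolding modulus_def by blast
  \<comment> \<open>The hypothesis bounds the maximum of the two perturbations, while the Hoelder
    estimate asks for a bound on their sum; hence the half.\<close>
  define \<epsilon> where "\<epsilon> = min \<epsilon>1 (\<epsilon>2 / 2)"
  have "\<epsilon> > 0" using R(1) \<theta>(2) by (simp add: \<epsilon>_def)
  have "(Sol m B b \<noteq> {} \<and> bounded (Sol m B b)) \<and> Sol m B b \<subseteq> Sol m A a +
      (\<lambda>u. (\<gamma> * (tensor_norm m (B - A) + norm (b - a)) powr c) *\<^sub>R u) ` cball 0 1"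
    if near: "max (tensor_norm m (B - A)) (norm (b - a)) < \<epsilon>" and cop: "copositive m B" for B b
  proof (intro conjI)
    have Sol_le: "norm x \<le> R" if "x \<in> Sol m B b" for x
      using near by (intro R(3)[OF cop _ _ Sol_imp_truncated_VI[OF that]]) (auto simp: \<epsilon>_def)
    then show "bounded (Sol m B b)"
      unfolding bounded_iff by blast
    \<comment> \<open>At radius \<open>R + 1\<close> a truncated solution cannot lie on the bounding
      sphere, where its norm would be at most \<open>R\<close>; so it is a genuine solution.\<close>
    obtain x where x: "truncated_VI m B b (R + 1) x"
      using truncated_VI_solvable[of "R + 1" m B b] \<open>R \<ge> 0\<close> by auto
    have "norm x \<noteq> R + 1"
    proof
      assume *: "norm x = R + 1"
      with x have "truncated_VI m B b (norm x) x" by simp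
      then have "norm x \<le> R" using near cop by (intro R(3)[of B b]) (auto simp: \<epsilon>_def)
      with * show False by simp
    qed
    moreover have "norm x \<le> R + 1"
      using x by (simp add: truncated_VI_def orthant_ball_def)
    ultimately show "Sol m B b \<noteq> {}"
      using truncated_VI_imp_Sol[OF x] by force
    define \<rho> where "\<rho> = \<gamma> * (tensor_norm m (B - A) + norm (b - a)) powr c"
    have "\<rho> \<ge> 0" using \<gamma>(1) by (simp add: \<rho>_def)
    have "x \<in> Sol m A a + (\<lambda>u. \<rho> *\<^sub>R u) ` cball 0 1" if x: "x \<in> Sol m B b" for x
    proof -
      have "tensor_norm m (B - A) + norm (b - a) \<le> \<epsilon>2"
        using near unfolding \<epsilon>_def by linarith
      then obtain x' where x': "x' \<in> Sol m A a" "norm (x - x') \<le> \<rho>"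
        using \<theta>(3)[OF _ x Sol_le[OF x]] by (auto simp: \<gamma>(3) \<rho>_def)
      have "x - x' \<in> (\<lambda>u. \<rho> *\<^sub>R u) ` cball 0 1"
      \<comment> \<open>For \<open>\<rho> = 0\<close> the scaled ball is {0} and x coincides with
        x'; otherwise the difference is divided by \<open>\<rho>\<close> to obtain the point of the
        unit ball.\<close>
      proof (cases "\<rho> = 0")
        case True
        then show ?thesis using x'(2) by (intro image_eqI[of _ _ 0]) auto
      next
        case False
        then have "norm ((x - x') /\<^sub>R \<rho>) \<le> 1"
          using x'(2) \<open>\<rho> \<ge> 0\<close> by (simp add: divide_inverse_commute[symmetric])
        then show ?thesis
          using False by (intro image_eqI[of _ _ "(x - x') /\<^sub>R \<rho>"]) auto
      qed
      then have "x' + (x - x') \<in> Sol m A a + (\<lambda>u. \<rho> *\<^sub>R u) ` cball 0 1"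
        using x'(1) by (rule set_plus_intro[rotated])
      then show ?thesis by simp
    qed
    then show "Sol m B b \<subseteq> Sol m A a +
      (\<lambda>u. (\<gamma> * (tensor_norm m (B - A) + norm (b - a)) powr c) *\<^sub>R u) ` cball 0 1"
      unfolding \<rho>_def by blast
  qed
  then show ?thesis
    using \<open>\<epsilon> > 0\<close> \<gamma>(1,2) by blast
qed

end
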